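(* Let $\mathcal{L}\subset\mathbb{R}^n$ be an admissible periodic set of points and let $F_\varepsilon$ be the nearest-neighbor energies defined in the context. Let $A\subset\mathbb{R}^n$ be open and let $X_\varepsilon\subset\varepsilon\mathcal{L}$ (for $\varepsilon\to0$) be such that $$\sup_{\varepsilon>0}F_\varepsilon(X_\varepsilon,A)<+\infty.$$ Let $V_\varepsilon=\bigcup_{x\in X_\varepsilon}\mathcal{V}_\varepsilon(x)$. Then there exist a set $V\subset A$ of finite perimeter in $A$ and a subsequence (not relabeled) such that $\chi_{V_\varepsilon}\to\chi_V$ strongly in $L^1_{\mathrm{loc}}(A)$.
   Context: Admissible: a countable set $\mathcal{L}\subset\mathbb{R}^n$ is admissible if (L1) there is $R>0$ with $\#(\mathcal{L}\cap B_R(x))\ge1$ for all $x\in\mathbb{R}^n$, and (L2) there is $r>0$ with $\mathrm{dist}(x,\mathcal{L}\setminus\{x\})\ge r$ for all $x\in\mathcal{L}$. Periodic: there is a basis $\{e_1,\dots,e_n\}$ of $\mathbb{R}^n$ with $\mathcal{L}+e_k=\mathcal{L}$ for all $k$. Voronoi cells: $\mathcal{V}(x)=\{z\in\mathbb{R}^n\colon|x-z|\le|y-z|\ \forall y\in\mathcal{L}\}$ for $x\in\mathcal{L}$, and $\mathcal{V}_\varepsilon(x)=\varepsilon\mathcal{V}(\varepsilon^{-1}x)$ for $x\in\varepsilon\mathcal{L}$. Nearest neighbors: $\mathcal{NN}(\mathcal{L})=\{(x,y)\in\mathcal{L}\times\mathcal{L}\colon x\neq y,\ \mathcal{H}^{n-1}(\mathcal{V}(x)\cap\mathcal{V}(y))>0\}$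 (ordered pairs). Energies: fix $c_{nn}\colon\mathbb{R}^n\to[0,+\infty]$ and $C\geq 1$ with $C^{-1}\le c_{nn}\le C$. For $\varepsilon>0$, $X\subset\varepsilon\mathcal{L}$, $A\subset\mathbb{R}^n$, $$F_\varepsilon(X,A)=\sum_{(x,y)\in\mathcal{NN}(\mathcal{L}),\ \varepsilon x\in A}\varepsilon^{n-1}c_{nn}(x-y)\,|\chi_X(\varepsilon x)-\chi_X(\varepsilon y)|.$$ *)

theory Defs
  imports "HOL-Analysis.Analysis"
begin

section \<open>Discrete sets, Voronoi cells and nearest neighbours\<close>

text \<open>In (L2) the distance to the empty set is 0 for \<open>infdist\<close> (rather than infinity); this case
  cannot arise, since (L1) forces \<open>L\<close> to be infinite.\<close>

definition admissible :: "(real ^ 'n) set \<Rightarrow> bool" where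
  "admissible L \<longleftrightarrow> countable L
     \<and> (\<exists>R>0. \<forall>x. L \<inter> ball x R \<noteq> {})
     \<and> (\<exists>r>0. \<forall>x\<in>L. infdist x (L - {x}) \<ge> r)"

definition periodic :: "(real ^ 'n) set \<Rightarrow> bool" where
  "periodic L \<longleftrightarrow>
     (\<exists>B. independent B \<and> span B = UNIV \<and> (\<forall>e\<in>B. (\<lambda>x. x + e) ` L = L))"

definition voronoi :: "(real ^ 'n) set \<Rightarrow> real ^ 'n \<Rightarrow> (real ^ 'n) set" where
  "voronoi L x = {z. \<forall>y\<in>L. norm (x - z) \<le> norm (y - z)}"

definition scaled_voronoi :: "(real ^ 'n) set \<Rightarrow> real \<Rightarrow> real ^ 'n \<Rightarrow> (real ^ 'n) set" where
  "scaled_voronoi L \<epsilon> x = (\<lambda>z. \<epsilon> *\<^sub>R z) ` voronoi L (inverse \<epsilon> *\<^sub>R x)"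

text \<open>Hausdorff measure of integer dimension \<open>k\<close>, normalised so that it agrees with the Lebesgue
  measure on \<open>k\<close>-dimensional planes (and with the counting measure if \<open>k = 0\<close>). In a
  covering, the empty set contributes 0, whereas for \<open>k = 0\<close> a single point contributes
  1. Boundedness is required explicitly because \<open>diameter\<close> is real-valued and carries no
  information for unbounded sets.\<close>

definition hausdorff_gauge :: "nat \<Rightarrow> 'a::metric_space set \<Rightarrow> ennreal" where
  "hausdorff_gauge k C =
     (if C = {} then 0 else ennreal (unit_ball_vol (real k) * (diameter C / 2) ^ k))"

definition hausdorff_premeasure :: "nat \<Rightarrow> real \<Rightarrow> 'a::metric_space set \<Rightarrow> ennreal" where
  "hausdorff_premeasure k \<delta> E =
     (INF C \<in> {C :: nat \<Rightarrow> 'a set. E \<subseteq> (\<Union>i. C i) \<and> (\<forall>i. bounded (C i) \<and> diameter (C i) \<le> \<delta>)}.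
        \<Sum>i. hausdorff_gauge k (C i))"

definition hausdorff_measure :: "nat \<Rightarrow> 'a::metric_space set \<Rightarrow> ennreal" where
  "hausdorff_measure k E = (SUP \<delta>\<in>{0<..}. hausdorff_premeasure k \<delta> E)"

definition nearest_neighbors :: "(real ^ 'n) set \<Rightarrow> ((real ^ 'n) \<times> (real ^ 'n)) set" where
  "nearest_neighbors L =
     {(x, y). x \<in> L \<and> y \<in> L \<and> x \<noteq> y
        \<and> hausdorff_measure (CARD('n) - 1) (voronoi L x \<inter> voronoi L y) > 0}"

section \<open>Nearest-neighbour energies\<close>

definition nn_energy ::
    "(real ^ 'n) set \<Rightarrow> (real ^ 'n \<Rightarrow> ennreal) \<Rightarrow> real \<Rightarrow> (real ^ 'n) set \<Rightarrow> (real ^ 'n) set \<Rightarrow> ennreal"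
  where
  "nn_energy L c \<epsilon> X A =
     (\<Sum>\<^sub>\<infinity>(x, y) \<in> {(x, y) \<in> nearest_neighbors L. \<epsilon> *\<^sub>R x \<in> A}.
        ennreal (\<epsilon> ^ (CARD('n) - 1)) * c (x - y)
          * ennreal \<bar>indicator X (\<epsilon> *\<^sub>R x) - indicator X (\<epsilon> *\<^sub>R y)\<bar>)"

section \<open>Sets of finite perimeter and local convergence\<close>

definition divergence :: "(real ^ 'n \<Rightarrow> real ^ 'n) \<Rightarrow> real ^ 'n \<Rightarrow> real" where
  "divergence \<phi> x = (\<Sum>i\<in>UNIV. frechet_derivative \<phi> (at x) (axis i 1) $ i)"

text \<open>The space \<open>C\<^sub>c\<^sup>1(A; \<real>\<^sup>n)\<close>, with its elements extended by zero outside \<open>A\<close>.\<close>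

definition C1_compactly_supported :: "(real ^ 'n) set \<Rightarrow> (real ^ 'n \<Rightarrow> real ^ 'n) set" where
  "C1_compactly_supported A =
     {\<phi>. (\<exists>\<phi>' :: real ^ 'n \<Rightarrow> (real ^ 'n) \<Rightarrow>\<^sub>L (real ^ 'n). continuous_on UNIV \<phi>'
             \<and> (\<forall>x. (\<phi> has_derivative blinfun_apply (\<phi>' x)) (at x)))
        \<and> compact (closure {x. \<phi> x \<noteq> 0}) \<and> closure {x. \<phi> x \<noteq> 0} \<subseteq> A}"

definition perimeter :: "(real ^ 'n) set \<Rightarrow> (real ^ 'n) set \<Rightarrow> ereal" where
  "perimeter V A =
     (SUP \<phi>\<in>{\<phi> \<in> C1_compactly_supported A. \<forall>x. norm (\<phi> x) \<le> 1}.
        ereal (LINT x:V|lebesgue. divergence \<phi> x))"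

definition finite_perimeter_in :: "(real ^ 'n) set \<Rightarrow> (real ^ 'n) set \<Rightarrow> bool" where
  "finite_perimeter_in V A \<longleftrightarrow> V \<in> sets lebesgue \<and> perimeter V A < \<infinity>"

definition converges_L1_loc ::
    "(real ^ 'n) set \<Rightarrow> (nat \<Rightarrow> real ^ 'n \<Rightarrow> real) \<Rightarrow> (real ^ 'n \<Rightarrow> real) \<Rightarrow> bool" where
  "converges_L1_loc A f g \<longleftrightarrow>
     (\<forall>K. compact K \<and> K \<subseteq> A \<longrightarrow>
        (\<forall>j. set_integrable lebesgue K (f j)) \<and> set_integrable lebesgue K g
        \<and> (\<lambda>j. LINT x:K|lebesgue. \<bar>f j x - g x\<bar>) \<longlonglongrightarrow> 0)"

end

theory Submission
  imports Defs "HOL-Library.Diagonal_Subsequence"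
begin

text \<open>Everything rests on an estimate for translations: if \<open>W\<close> is the union of the scaled Voronoi cells
  of \<open>X\<close>, then the set of those \<open>z \<in> K\<close> for which exactly one of \<open>z\<close>, \<open>z + h\<close> lies in \<open>W\<close> has
  measure at most \<open>M (|h| + O(\<epsilon>))\<close>, where \<open>M\<close> depends only on the energy bound. Indeed the segment from \<open>z\<close> to
  \<open>z + h\<close> meets the common boundary of a cell of \<open>X\<close> and a cell outside of it. Pairs of cells whose
  common boundary is \<open>(n-1)\<close>-null sweep out a null set of such \<open>z\<close>, and each nearest-neighbour pair
  sweeps out a tube of volume \<open>O(\<epsilon>\<^sup>n\<^sup>-\<^sup>1 (|h| + \<epsilon>))\<close>; the energy counts these pairs.

  As in the Kolmogorov-Riesz theorem the estimate gives local \<open>L\<^sup>1\<close> compactness: except on a set of small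
  measure, membership in \<open>W\<close> is decided by majority vote on one of finitely many small balls, so
  that a pigeonhole and a diagonal argument produce a subsequence that is Cauchy on every compact
  set. The limit \<open>V\<close> satisfies the estimate with \<open>\<epsilon> = 0\<close>, that is, the translates of \<open>V\<close> depend on
  \<open>h\<close> in a Lipschitz way, and passing to the limit in difference quotients bounds the perimeter by \<open>n M\<close>.\<close>

section \<open>Sets swept out along a vector\<close>

text \<open>The Minkowski sum of \<open>S\<close> and the segment from \<open>- h\<close> to 0. It
  collects the starting points of the segments that hit \<open>S\<close>, since the translation
  estimate measures the set of such starting points.\<close>

definition sweep :: "'a::real_normed_vector \<Rightarrow> 'a set \<Rightarrow> 'a set" where
  "sweep h S = {z. \<exists>t\<in>{0..1}. z + t *\<^sub>R h \<in> S}"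

lemma sweep_eq_image: "sweep h S = (\<lambda>p. snd p - fst p *\<^sub>R h) ` ({0..1} \<times> S)"
proof (intro equalityI subsetI)
  fix z assume "z \<in> sweep h S"
  then obtain t where "t \<in> {0..1}" "z + t *\<^sub>R h \<in> S" by (auto simp: sweep_def)
  then show "z \<in> (\<lambda>p. snd p - fst p *\<^sub>R h) ` ({0..1} \<times> S)"
    by (intro image_eqI[of _ _ "(t, z + t *\<^sub>R h)"]) auto
qed (auto simp: sweep_def intro!: bexI)

lemma compact_sweep: "compact S \<Longrightarrow> compact (sweep h S)"
  unfolding sweep_eq_image
  by (intro compact_continuous_image compact_Times compact_Icc continuous_intros)

lemma sweep_mono: "S \<subseteq> T \<Longrightarrow> sweep h S \<subseteq> sweep h T"
  by (auto simp: sweep_def)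

lemma sweep_UN: "sweep h (\<Union>i\<in>I. S i) = (\<Union>i\<in>I. sweep h (S i))"
  by (auto simp: sweep_def)

lemma sweep_scaleR:
  assumes "e \<noteq> 0"
  shows "sweep h ((\<lambda>x. e *\<^sub>R x) ` S) = (\<lambda>x. e *\<^sub>R x) ` sweep (h /\<^sub>R e) S"
proof (rule set_eqI)
  fix z
  have "(z + t *\<^sub>R h \<in> (\<lambda>x. e *\<^sub>R x) ` S) \<longleftrightarrow> (z /\<^sub>R e + t *\<^sub>R (h /\<^sub>R e) \<in> S)" for t
  proof -
    have "z + t *\<^sub>R h = e *\<^sub>R (z /\<^sub>R e + t *\<^sub>R (h /\<^sub>R e))"
      using assms by (simp add: scaleR_add_right)
    then show ?thesis using assms by (metis (no_types) inj_image_mem_iff injective_scaleR)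
  qed
  moreover have "z \<in> (\<lambda>x. e *\<^sub>R x) ` T \<longleftrightarrow> z /\<^sub>R e \<in> T" for T
    using assms by (auto simp: image_iff intro!: bexI[of _ "z /\<^sub>R e"])
  ultimately show "z \<in> sweep h ((\<lambda>x. e *\<^sub>R x) ` S) \<longleftrightarrow> z \<in> (\<lambda>x. e *\<^sub>R x) ` sweep (h /\<^sub>R e) S"
    by (simp add: sweep_def)
qed

lemma sets_sweep_cball [measurable]:
  "sweep h (cball x r) \<in> sets (borel :: 'a::euclidean_space measure)"
  by (intro borel_closed compact_imp_closed compact_sweep compact_cball)

text \<open>Rounding the parameter \<open>t\<close> down to a multiple of \<open>r / norm h\<close>
  moves the point by at most \<open>r\<close>. Hence the balls of doubled radius around these
  finitely many positions cover the tube.\<close>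

lemma sweep_cball_subset:
  fixes x h :: "'a::euclidean_space"
  assumes "r > 0"
  shows "sweep h (cball x r) \<subseteq>
    (\<Union>k\<in>{..nat \<lceil>norm h / r\<rceil>}. cball (x - (real k * r / norm h) *\<^sub>R h) (2 * r))"
proof
  fix z assume "z \<in> sweep h (cball x r)"
  then obtain t where t: "0 \<le> t" "t \<le> 1" "norm (z + t *\<^sub>R h - x) \<le> r"
    by (auto simp: sweep_def dist_norm norm_minus_commute)
  define k where "k = nat \<lfloor>t * norm h / r\<rfloor>"
  have nn: "0 \<le> t * norm h / r" using t assms by auto
  have k: "real k \<le> t * norm h / r" "t * norm h / r \<le> real k + 1"
    unfolding k_def using nn by linarith+
  have "t * norm h / r \<le> norm h / r"
    using t assms by (intro divide_right_mono mult_left_le_one_le) auto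
  then have kle: "k \<le> nat \<lceil>norm h / r\<rceil>"
    using k by linarith
  have "norm (z - (x - (real k * r / norm h) *\<^sub>R h)) \<le> 2 * r"
  proof (cases "h = 0")
    case True
    with t assms show ?thesis by simp
  next
    case False
    have "norm ((t - real k * r / norm h) *\<^sub>R h) = \<bar>(t - real k * r / norm h) * norm h\<bar>"
      by (simp add: abs_mult)
    also have "(t - real k * r / norm h) * norm h = t * norm h - real k * r"
      using False by (simp add: left_diff_distrib)
    finally have "norm ((t - real k * r / norm h) *\<^sub>R h) \<le> r"
      using k assms by (simp add: field_simps abs_le_iff)
    then have "norm ((z + t *\<^sub>R h - x) - (t - real k * r / norm h) *\<^sub>R h) \<le> r + r"
      by (intro order_trans[OF norm_triangle_ineq4 add_mono] t(3))
    also have "(z + t *\<^sub>R h - x) - (t - real k * r / norm h) *\<^sub>R h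
        = z - (x - (real k * r / norm h) *\<^sub>R h)"
      by (simp add: algebra_simps)
    finally show ?thesis by simp
  qed
  then show "z \<in> (\<Union>k\<in>{..nat \<lceil>norm h / r\<rceil>}. cball (x - (real k * r / norm h) *\<^sub>R h) (2 * r))"
    using kle by (auto simp: dist_norm norm_minus_commute)
qed

text \<open>For \<open>r = 0\<close> the bound is the limit of those for positive radii: it vanishes unless the
  dimension is 1, in which case \<open>0 ^ 0 = 1\<close>.\<close>

lemma emeasure_sweep_cball_le:
  fixes x h :: "'a::euclidean_space"
  assumes "r \<ge> 0"
  shows "emeasure lborel (sweep h (cball x r)) \<le>
    ennreal (unit_ball_vol DIM('a) * 2 ^ DIM('a) * r ^ (DIM('a) - 1) * (norm h + 2 * r))"
proof -
  define w where "w = unit_ball_vol DIM('a) * 2 ^ DIM('a)"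
  have w: "w \<ge> 0" by (simp add: w_def)
  have pos: "emeasure lborel (sweep h (cball x r)) \<le> ennreal (w * r ^ (DIM('a) - 1) * (norm h + 2 * r))"
    if r: "r > 0" for r
  proof -
    let ?N = "nat \<lceil>norm h / r\<rceil>"
    have rn: "r ^ DIM('a) = r ^ (DIM('a) - 1) * r"
      by (metis DIM_positive Suc_diff_1 power_Suc2)
    have "emeasure lborel (sweep h (cball x r))
        \<le> emeasure lborel (\<Union>k\<in>{..?N}. cball (x - (real k * r / norm h) *\<^sub>R h) (2 * r))"
      using sweep_cball_subset[OF r] by (intro emeasure_mono) auto
    also have "\<dots> \<le> (\<Sum>k\<in>{..?N}. emeasure lborel (cball (x - (real k * r / norm h) *\<^sub>R h) (2 * r)))"
      by (intro emeasure_subadditive_finite) auto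
    also have "\<dots> = ennreal (real (?N + 1) * (unit_ball_vol DIM('a) * (2 * r) ^ DIM('a)))"
      using r by (simp add: emeasure_cball ennreal_of_nat_eq_real_of_nat ennreal_mult[symmetric]
          del: of_nat_Suc of_nat_add)
    also have "\<dots> \<le> ennreal ((norm h / r + 2) * (unit_ball_vol DIM('a) * (2 * r) ^ DIM('a)))"
    proof -
      have "0 \<le> norm h / r" using r by simp
      then have "real (?N + 1) \<le> norm h / r + 2" by linarith
      then show ?thesis
        using r by (intro ennreal_leI mult_right_mono) auto
    qed
    also have "(norm h / r + 2) * (unit_ball_vol DIM('a) * (2 * r) ^ DIM('a))
        = w * r ^ (DIM('a) - 1) * (norm h + 2 * r)"
      using r by (simp add: w_def power_mult_distrib rn field_simps)
    finally show ?thesis .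
  qed
  have "((\<lambda>s. ennreal (w * s ^ (DIM('a) - 1) * (norm h + 2 * s)))
      \<longlongrightarrow> ennreal (w * r ^ (DIM('a) - 1) * (norm h + 2 * r))) (at_right r)"
    by (intro tendsto_ennrealI tendsto_mult tendsto_add tendsto_power tendsto_const tendsto_ident_at)
  moreover have "\<forall>\<^sub>F s in at_right r. emeasure lborel (sweep h (cball x r))
      \<le> ennreal (w * s ^ (DIM('a) - 1) * (norm h + 2 * s))"
    unfolding eventually_at_right_field
  proof (intro exI[of _ "r + 1"] conjI allI impI)
    fix s assume s: "r < s" "s < r + 1"
    have "emeasure lborel (sweep h (cball x r)) \<le> emeasure lborel (sweep h (cball x s))"
      using s by (intro emeasure_mono sweep_mono subset_cball) auto
    also have "\<dots> \<le> ennreal (w * s ^ (DIM('a) - 1) * (norm h + 2 * s))"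
      using s assms by (intro pos) auto
    finally show "emeasure lborel (sweep h (cball x r)) \<le> \<dots>" .
  qed simp
  ultimately show ?thesis
    unfolding w_def[symmetric] by (rule tendsto_lowerbound) simp
qed

text \<open>A covering of \<open>S\<close> by sets of diameter \<open>d\<close> with small total of
  \<open>d ^ (n - 1)\<close> also controls the sweep: each set lies in a ball of radius
  \<open>d\<close>, whose tube along the fixed vector \<open>h\<close> has volume at most a constant
  times \<open>d ^ (n - 1)\<close>.\<close>

lemma null_sweep:
  fixes S :: "'a::euclidean_space set"
  assumes "hausdorff_measure (DIM('a) - 1) S = 0" and "compact S"
  shows "emeasure lborel (sweep h S) = 0"
proof -
  define m where "m = DIM('a) - 1"
  define w where "w = unit_ball_vol DIM('a) * 2 ^ DIM('a)"
  \<comment> \<open>The gauge of a nonempty set of diameter \<open>d\<close> is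
    \<open>v * d ^ m\<close>. The factor \<open>b\<close> turns it into the volume bound for the
    tube around a ball of radius \<open>d\<close>, where \<open>d \<le> 1\<close> is used to replace
    \<open>norm h + 2 * d\<close> by \<open>norm h + 2\<close>.\<close>
  define v where "v = unit_ball_vol (real m) / 2 ^ m"
  define b where "b = w * (norm h + 2) / v"
  have w: "w \<ge> 0" by (simp add: w_def)
  have v: "v > 0" by (simp add: v_def)
  have b: "b \<ge> 0" using w v by (simp add: b_def)
  have small: "emeasure lborel (sweep h S) \<le> ennreal b * ennreal \<eta>" if "\<eta> > 0" for \<eta>
  proof -
    \<comment> \<open>Coverings at the single scale 1 suffice: the premeasure lies below the
      supremum, which is 0, and only \<open>d \<le> 1\<close> is required of the diameters.\<close>
    have "hausdorff_premeasure m 1 S \<le> hausdorff_measure m S"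
      unfolding hausdorff_measure_def by (rule SUP_upper) auto
    then have "hausdorff_premeasure m 1 S < ennreal \<eta>"
      using assms(1) that by (simp add: m_def)
    then obtain D where D: "S \<subseteq> (\<Union>i. D i)" "\<And>i. bounded (D i)" "\<And>i. diameter (D i) \<le> 1"
      "(\<Sum>i. hausdorff_gauge m (D i)) < ennreal \<eta>"
      unfolding hausdorff_premeasure_def by (auto simp: INF_less_iff)
    have "\<exists>T \<in> sets borel. sweep h (D i) \<subseteq> T \<and> emeasure lborel T \<le> ennreal b * hausdorff_gauge m (D i)" for i
    proof (cases "D i = {}")
      case True
      then show ?thesis by (intro bexI[of _ "{}"]) (auto simp: sweep_def)
    next
      case False
      then obtain p where p: "p \<in> D i" by auto
      define d where "d = diameter (D i)"
      have d: "0 \<le> d" "d \<le> 1" using D diameter_ge_0[of "D i"] by (auto simp: d_def)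
      have "D i \<subseteq> cball p d"
        using diameter_bounded_bound[OF D(2) p] by (auto simp: d_def)
      then have "sweep h (D i) \<subseteq> sweep h (cball p d)" by (rule sweep_mono)
      moreover have "emeasure lborel (sweep h (cball p d)) \<le> ennreal b * hausdorff_gauge m (D i)"
      proof -
        have "emeasure lborel (sweep h (cball p d)) \<le> ennreal (w * d ^ m * (norm h + 2 * d))"
          using emeasure_sweep_cball_le[OF d(1)] by (simp add: w_def m_def)
        also have "\<dots> \<le> ennreal (w * d ^ m * (norm h + 2))"
          using d w by (intro ennreal_leI mult_left_mono) auto
        also have "w * d ^ m * (norm h + 2) = b * (v * d ^ m)"
          using v by (simp add: b_def)
        also have "ennreal \<dots> = ennreal b * hausdorff_gauge m (D i)"
          using False b v d
          by (subst ennreal_mult) (auto simp: hausdorff_gauge_def v_def d_def power_divide)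
        finally show ?thesis .
      qed
      ultimately show ?thesis by (intro bexI[of _ "sweep h (cball p d)"]) auto
    qed
    then obtain T where T: "\<And>i. T i \<in> sets borel" "\<And>i. sweep h (D i) \<subseteq> T i"
        "\<And>i. emeasure lborel (T i) \<le> ennreal b * hausdorff_gauge m (D i)"
      by metis
    have "sweep h S \<subseteq> (\<Union>i. T i)"
      using sweep_mono[OF D(1), of h] T(2) unfolding sweep_UN by blast
    then have "emeasure lborel (sweep h S) \<le> emeasure lborel (\<Union>i. T i)"
      using T(1) by (intro emeasure_mono) auto
    also have "\<dots> \<le> (\<Sum>i. emeasure lborel (T i))"
      using T(1) by (intro emeasure_subadditive_countably) auto
    also have "\<dots> \<le> (\<Sum>i. ennreal b * hausdorff_gauge m (D i))"
      using T(3) by (intro suminf_le) auto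
    also have "\<dots> = ennreal b * (\<Sum>i. hausdorff_gauge m (D i))" by simp
    also have "\<dots> \<le> ennreal b * ennreal \<eta>" using D(4) by (intro mult_left_mono) auto
    finally show ?thesis .
  qed
  have "emeasure lborel (sweep h S) \<le> 0"
  proof (rule ennreal_le_epsilon)
    fix \<eta> :: real assume "\<eta> > 0"
    then have "emeasure lborel (sweep h S) \<le> ennreal b * ennreal (\<eta> / (b + 1))"
      using b by (intro small) auto
    also have "\<dots> = ennreal (b * (\<eta> / (b + 1)))" using b \<open>\<eta> > 0\<close> by (intro ennreal_mult[symmetric]) auto
    also have "\<dots> \<le> ennreal \<eta>" using b \<open>\<eta> > 0\<close> by (intro ennreal_leI) (simp add: field_simps)
    finally show "emeasure lborel (sweep h S) \<le> 0 + ennreal \<eta>" by simp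
  qed
  then show ?thesis by simp
qed

text \<open>Nearest neighbours are defined through cells of the unscaled lattice, so the hypothesis
  concerns the unscaled set. Sweeping commutes with dilation once \<open>h\<close> is divided by
  \<open>e\<close>, and a dilation maps negligible sets to negligible sets.\<close>

lemma null_sweep_scaleR:
  fixes S :: "'a::euclidean_space set"
  assumes "hausdorff_measure (DIM('a) - 1) S = 0" and "compact S" and "e \<noteq> 0"
  shows "emeasure lborel (sweep h ((\<lambda>x. e *\<^sub>R x) ` S)) = 0"
proof -
  have c: "compact (sweep (h /\<^sub>R e) S)" by (rule compact_sweep) fact
  have "negligible (sweep (h /\<^sub>R e) S)"
    using null_sweep[OF assms(1,2), of "h /\<^sub>R e"] c
    by (simp add: negligible_iff_emeasure0 compact_imp_closed borel_closed emeasure_completion)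
  then have "negligible ((\<lambda>x. e *\<^sub>R x) ` sweep (h /\<^sub>R e) S)"
    by (intro negligible_differentiable_image_negligible) (auto intro!: derivative_intros)
  moreover have "compact ((\<lambda>x. e *\<^sub>R x) ` sweep (h /\<^sub>R e) S)"
    using c by (rule compact_scaling)
  ultimately show ?thesis
    using assms(3)
    by (simp add: sweep_scaleR negligible_iff_emeasure0 compact_imp_closed borel_closed emeasure_completion)
qed

section \<open>Interfaces between Voronoi cells\<close>

text \<open>By (L2) distinct points of \<open>Y\<close> stay at distance at least \<open>r\<close>,
  so they cannot accumulate. Arbitrary subsets of \<open>L\<close> are covered because nearest
  points will be chosen in \<open>Y\<close> and in \<open>L - Y\<close> separately.\<close>

lemma uniformly_discrete_closed:
  assumes "(\<forall>x\<in>L. infdist x (L - {x}) \<ge> r)" "r > 0" "Y \<subseteq> L"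
  shows "closed Y"
proof (rule discrete_imp_closed[OF \<open>r > 0\<close>], intro ballI impI)
  fix x y assume xy: "x \<in> Y" "y \<in> Y" "dist y x < r"
  show "y = x"
  proof (rule ccontr)
    assume "y \<noteq> x"
    then have "infdist x (L - {x}) \<le> dist x y" using xy assms by (intro infdist_le) auto
    moreover have "infdist x (L - {x}) \<ge> r" using assms xy by auto
    ultimately show False using xy by (simp add: dist_commute)
  qed
qed

section \<open>Elementary geometry of Voronoi cells and crossings between them\<close>

lemma voronoi_dist: "z \<in> voronoi L x \<longleftrightarrow> (\<forall>y\<in>L. dist z x \<le> dist z y)"
  by (simp add: voronoi_def dist_norm norm_minus_commute)

lemma closed_voronoi: "closed (voronoi L x)"
proof -
  have "voronoi L x = (\<Inter>y\<in>L. {z. norm (x - z) \<le> norm (y - z)})"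
    by (auto simp: voronoi_def)
  then show ?thesis
    by (auto intro!: closed_INT closed_Collect_le continuous_intros)
qed

text \<open>By (L1) every \<open>z\<close> has a lattice point at distance less than
  \<open>R\<close>, and for \<open>z\<close> in the cell of \<open>x\<close> the point
  \<open>x\<close> is at least as close.\<close>

lemma voronoi_subset_cball:
  assumes "\<forall>x. L \<inter> ball x R \<noteq> {}"
  shows "voronoi L x \<subseteq> cball x R"
proof
  fix z assume z: "z \<in> voronoi L x"
  obtain y where "y \<in> L" "dist z y < R" using assms[rule_format, of z] by auto
  then have "dist z x \<le> R" using z unfolding voronoi_dist by force
  then show "z \<in> cball x R" by (simp add: dist_commute)
qed

lemma compact_voronoi_Int:
  assumes "\<forall>x. L \<inter> ball x R \<noteq> {}"
  shows "compact (voronoi L x \<inter> voronoi L y)"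
  using voronoi_subset_cball[OF assms]
  by (intro compact_Int_closed closed_voronoi)
     (metis bounded_subset bounded_cball closed_voronoi compact_eq_bounded_closed)

lemma voronoi_covers:
  assumes "closed L" "L \<noteq> {}"
  obtains x where "x \<in> L" "z \<in> voronoi L x"
proof -
  obtain x where "x \<in> L" "infdist z L = dist z x"
    using infdist_attains_inf[OF assms, of z] by auto
  then show ?thesis using that infdist_le[of _ L z] by (auto simp: voronoi_dist)
qed

text \<open>The difference of the distances to \<open>Y\<close> and to \<open>L - Y\<close> changes its sign along the segment from
  \<open>u\<close> to \<open>v\<close>; where it vanishes, a cell of \<open>Y\<close> meets a cell of \<open>L - Y\<close>.\<close>

lemma segment_meets_interface:
  fixes L :: "(real^'n) set"
  assumes clo: "\<And>Y. Y \<subseteq> L \<Longrightarrow> closed Y" and "L \<noteq> {}" and Y: "Y \<subseteq> L"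
    and u: "u \<in> (\<Union>x\<in>Y. voronoi L x)" and v: "v \<notin> (\<Union>x\<in>Y. voronoi L x)"
  obtains t x y where "t \<in> {0..1}" "x \<in> Y" "y \<in> L - Y"
    "u + t *\<^sub>R (v - u) \<in> voronoi L x \<inter> voronoi L y"
proof -
  obtain x0 where x0: "x0 \<in> Y" "u \<in> voronoi L x0" using u by auto
  obtain y0 where y0: "y0 \<in> L" "v \<in> voronoi L y0" using voronoi_covers[OF clo] assms by blast
  \<comment> \<open>Together with \<open>x0\<close> this shows that \<open>Y\<close> and
    \<open>L - Y\<close> are both nonempty, so that \<open>infdist\<close> is a true distance to
    each of them and not the default value 0.\<close>
  have y0': "y0 \<in> L - Y" using y0 v by auto
  define g where "g z = infdist z Y - infdist z (L - Y)" for z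
  have gu: "g u \<le> 0"
  proof -
    have "infdist u Y \<le> dist u x0" using x0 by (intro infdist_le)
    also have "\<dots> \<le> infdist u (L - Y)"
      using x0 y0' by (subst infdist_notempty) (auto intro!: cINF_greatest simp: voronoi_dist)
    finally show ?thesis by (simp add: g_def)
  qed
  have gv: "0 \<le> g v"
  proof -
    have "infdist v (L - Y) \<le> dist v y0" using y0' by (intro infdist_le)
    also have "\<dots> \<le> infdist v Y"
      using x0 y0 Y by (subst infdist_notempty) (auto intro!: cINF_greatest simp: voronoi_dist)
    finally show ?thesis by (simp add: g_def)
  qed
  have "continuous_on {0..1} (\<lambda>t::real. g (u + t *\<^sub>R (v - u)))"
    unfolding g_def by (intro continuous_intros)
  then obtain t where t: "0 \<le> t" "t \<le> 1" "g (u + t *\<^sub>R (v - u)) = 0"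
    using IVT'[of "\<lambda>t. g (u + t *\<^sub>R (v - u))" 0 0 1] gu gv by auto
  define w where "w = u + t *\<^sub>R (v - u)"
  obtain x where x: "x \<in> Y" "infdist w Y = dist w x"
    using infdist_attains_inf[of Y w] clo[OF Y] x0 by auto
  obtain y where y: "y \<in> L - Y" "infdist w (L - Y) = dist w y"
    using infdist_attains_inf[of "L - Y" w] clo[of "L - Y"] y0' by auto
  have eq: "dist w x = dist w y" using t x y by (simp add: g_def w_def)
  have "dist w x \<le> dist w z" if "z \<in> L" for z
    using infdist_le[of z Y w] infdist_le[of z "L - Y" w] that x y eq by auto
  then have "w \<in> voronoi L x \<inter> voronoi L y" using eq by (simp add: voronoi_dist)
  with that t x y show ?thesis by (auto simp: w_def)
qed

text \<open>Division by \<open>e\<close> reduces the claim to the unscaled lattice, with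
  \<open>Y\<close> in place of \<open>X\<close>. There \<open>segment_meets_interface\<close> is
  applied starting from whichever endpoint lies in the union of cells.\<close>

lemma scaled_voronoi_transition:
  fixes L :: "(real^'n) set"
  assumes clo: "\<And>Y. Y \<subseteq> L \<Longrightarrow> closed Y" and "L \<noteq> {}" and "e > 0" and X: "X \<subseteq> (\<lambda>x. e *\<^sub>R x) ` L"
    and ne: "(z \<in> (\<Union>x\<in>X. scaled_voronoi L e x)) \<noteq> (z + h \<in> (\<Union>x\<in>X. scaled_voronoi L e x))"
  obtains x y where "x \<in> L" "y \<in> L" "(e *\<^sub>R x \<in> X) \<noteq> (e *\<^sub>R y \<in> X)"
    "z \<in> sweep h ((\<lambda>z. e *\<^sub>R z) ` (voronoi L x \<inter> voronoi L y))"
proof -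
  define Y where "Y = {x \<in> L. e *\<^sub>R x \<in> X}"
  have YL: "Y \<subseteq> L" by (auto simp: Y_def)
  have mem: "p \<in> (\<Union>x\<in>X. scaled_voronoi L e x) \<longleftrightarrow> p /\<^sub>R e \<in> (\<Union>x\<in>Y. voronoi L x)" for p
  proof -
    have "p \<in> scaled_voronoi L e x \<longleftrightarrow> p /\<^sub>R e \<in> voronoi L (x /\<^sub>R e)" for x
      using \<open>e > 0\<close> by (auto simp: scaled_voronoi_def image_iff intro!: bexI[of _ "p /\<^sub>R e"])
    moreover have "x \<in> X \<Longrightarrow> x /\<^sub>R e \<in> Y" for x
      using X \<open>e > 0\<close> by (auto simp: Y_def)
    moreover have "x \<in> Y \<Longrightarrow> e *\<^sub>R x \<in> X" for x
      by (auto simp: Y_def)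
    ultimately show ?thesis
      using \<open>e > 0\<close> by (auto; fastforce)
  qed
  note witness = that
  have *: thesis if t: "t \<in> {0..1}" and "x \<in> Y" "y \<in> L - Y" and w: "w \<in> voronoi L x \<inter> voronoi L y"
    and "z + t *\<^sub>R h = e *\<^sub>R w" for t x y w
  proof (rule witness[of x y])
    show "z \<in> sweep h ((\<lambda>z. e *\<^sub>R z) ` (voronoi L x \<inter> voronoi L y))"
      using that by (auto simp: sweep_def)
  qed (use that in \<open>auto simp: Y_def\<close>)
  show thesis
  proof (cases "z \<in> (\<Union>x\<in>X. scaled_voronoi L e x)")
    case True
    then have "z /\<^sub>R e \<in> (\<Union>x\<in>Y. voronoi L x)" "(z + h) /\<^sub>R e \<notin> (\<Union>x\<in>Y. voronoi L x)"
      using ne unfolding mem by blast+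
    then obtain t x y where t: "t \<in> {0..1}" "x \<in> Y" "y \<in> L - Y"
      "z /\<^sub>R e + t *\<^sub>R ((z + h) /\<^sub>R e - z /\<^sub>R e) \<in> voronoi L x \<inter> voronoi L y"
      using segment_meets_interface[OF clo \<open>L \<noteq> {}\<close> YL] by blast
    show ?thesis
      by (rule *[OF t]) (use \<open>e > 0\<close> in \<open>simp add: algebra_simps\<close>)
  next
    case False
    then have "(z + h) /\<^sub>R e \<in> (\<Union>x\<in>Y. voronoi L x)" "z /\<^sub>R e \<notin> (\<Union>x\<in>Y. voronoi L x)"
      using ne unfolding mem by blast+
    then obtain t x y where t: "t \<in> {0..1}" "x \<in> Y" "y \<in> L - Y"
      "(z + h) /\<^sub>R e + t *\<^sub>R (z /\<^sub>R e - (z + h) /\<^sub>R e) \<in> voronoi L x \<inter> voronoi L y"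
      using segment_meets_interface[OF clo \<open>L \<noteq> {}\<close> YL] by blast
    \<comment> \<open>The segment was traversed from \<open>z + h\<close> back to \<open>z\<close>,
      so the parameter has to be reversed.\<close>
    have "1 - t \<in> {0..1}" using t by auto
    then show ?thesis
      by (rule *[OF _ t(2,3,4)]) (use \<open>e > 0\<close> in \<open>simp add: algebra_simps\<close>)
  qed
qed

section \<open>Counting interfaces by the energy and the translation estimate\<close>

definition nn_interface :: "(real ^ 'n) set \<Rightarrow> real \<Rightarrow> (real ^ 'n) set \<Rightarrow> (real ^ 'n) set
    \<Rightarrow> ((real ^ 'n) \<times> (real ^ 'n)) set" where
  "nn_interface L e X A =
    {(x, y) \<in> nearest_neighbors L. e *\<^sub>R x \<in> A \<and> (e *\<^sub>R x \<in> X) \<noteq> (e *\<^sub>R y \<in> X)}"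

text \<open>Each pair in \<open>nn_interface\<close> contributes at least
  \<open>e ^ (n - 1) / C\<close> to the energy. The bound is first shown for finite subsets; being
  uniform, it forces finiteness, without which \<open>card\<close> would be the default value 0 and
  the second claim empty.\<close>

lemma card_nn_interface_le:
  fixes L :: "(real^'n) set"
  assumes c: "\<And>z. ennreal (inverse C) \<le> c z" and C: "C > 0" and e: "e > 0" and M: "M \<ge> 0"
    and en: "nn_energy L c e X A \<le> ennreal M"
  shows "finite (nn_interface L e X A)"
    and "real (card (nn_interface L e X A)) * e ^ (CARD('n) - 1) \<le> C * M"
proof -
  have *: "real (card F) * e ^ (CARD('n) - 1) \<le> C * M"
    if F: "F \<subseteq> nn_interface L e X A" "finite F" for F
  proof -
    let ?f = "\<lambda>(x, y). ennreal (e ^ (CARD('n) - 1)) * c (x - y)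
          * ennreal \<bar>indicator X (e *\<^sub>R x) - indicator X (e *\<^sub>R y)\<bar>"
    have "ennreal (real (card F) * (e ^ (CARD('n) - 1) * inverse C))
        = (\<Sum>p\<in>F. ennreal (e ^ (CARD('n) - 1) * inverse C))"
      using e C by (simp add: ennreal_of_nat_eq_real_of_nat ennreal_mult)
    also have "\<dots> \<le> (\<Sum>p\<in>F. ?f p)"
    proof (rule sum_mono)
      fix p assume "p \<in> F"
      then have p: "(e *\<^sub>R fst p \<in> X) \<noteq> (e *\<^sub>R snd p \<in> X)"
        using F by (auto simp: nn_interface_def)
      then have one: "\<bar>indicator X (e *\<^sub>R fst p) - indicator X (e *\<^sub>R snd p)\<bar> = (1::real)"
        by (auto simp: indicator_def)
      have "ennreal (e ^ (CARD('n) - 1) * inverse C) = ennreal (e ^ (CARD('n) - 1)) * ennreal (inverse C)"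
        using e C by (intro ennreal_mult) auto
      also have "\<dots> \<le> ennreal (e ^ (CARD('n) - 1)) * c (fst p - snd p)"
        using c by (intro mult_left_mono) auto
      finally show "ennreal (e ^ (CARD('n) - 1) * inverse C) \<le> ?f p"
        using one by (simp add: case_prod_unfold)
    qed
    also have "\<dots> = infsum ?f F" using F by simp
    also have "\<dots> \<le> nn_energy L c e X A"
      unfolding nn_energy_def
      using F by (intro infsum_mono_neutral nonneg_summable_on_complete) (auto simp: nn_interface_def)
    also have "\<dots> \<le> ennreal M" by (rule en)
    finally have "real (card F) * (e ^ (CARD('n) - 1) * inverse C) \<le> M"
      using M by simp
    then show ?thesis using C by (simp add: field_simps)
  qed
  show fin: "finite (nn_interface L e X A)"
  proof -
    have "card F \<le> nat \<lceil>C * M / e ^ (CARD('n) - 1)\<rceil>"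
      if "F \<subseteq> nn_interface L e X A" "finite F" for F
    proof -
      have "real (card F) \<le> C * M / e ^ (CARD('n) - 1)"
        using *[OF that] e by (simp add: pos_le_divide_eq)
      then show ?thesis by linarith
    qed
    then show ?thesis using finite_if_finite_subsets_card_bdd by blast
  qed
  show "real (card (nn_interface L e X A)) * e ^ (CARD('n) - 1) \<le> C * M"
    using *[OF subset_refl fin] .
qed

lemma emeasure_transition_le:
  fixes L :: "(real^'n) set"
  assumes clo: "\<And>Y. Y \<subseteq> L \<Longrightarrow> closed Y" and "countable L"
    and R: "\<forall>x. L \<inter> ball x R \<noteq> {}" "R > 0"
    and c: "\<And>z. ennreal (inverse C) \<le> c z" and C: "C > 0" and e: "e > 0" and M: "M \<ge> 0"
    and en: "nn_energy L c e X A \<le> ennreal M" and X: "X \<subseteq> (\<lambda>x. e *\<^sub>R x) ` L"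
    and K: "\<And>z. z \<in> K \<Longrightarrow> cball z \<delta> \<subseteq> A" and \<delta>: "norm h + e * R \<le> \<delta>"
  defines "W \<equiv> (\<Union>x\<in>X. scaled_voronoi L e x)"
  shows "emeasure lborel {z \<in> K. (z \<in> W) \<noteq> (z + h \<in> W)} \<le>
    ennreal (unit_ball_vol CARD('n) * 2 ^ CARD('n) * R ^ (CARD('n) - 1) * (C * M) * (norm h + 2 * (e * R)))"
proof -
  define D where "D = nn_interface L e X A"
  \<comment> \<open>Pairs that are not nearest neighbours may be crossed too, but they are countably
    many and each has an interface of zero Hausdorff measure, so together they sweep out a null
    set.\<close>
  define N where "N = {(x, y). x \<in> L \<and> y \<in> L \<and> x \<noteq> y \<and> (x, y) \<notin> nearest_neighbors L}"
  define S where "S = (\<lambda>(x, y). sweep h ((\<lambda>z. e *\<^sub>R z) ` (voronoi L x \<inter> voronoi L y)))"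
  define w where "w = unit_ball_vol CARD('n) * 2 ^ CARD('n)"
  have w: "w \<ge> 0" by (simp add: w_def)
  have "L \<noteq> {}" using R by auto
  have fin: "finite D" and card: "real (card D) * e ^ (CARD('n) - 1) \<le> C * M"
    using card_nn_interface_le[OF c C e M en] by (auto simp: D_def)
  have Sborel [measurable]: "S p \<in> sets borel" for p
    unfolding S_def case_prod_unfold
    by (intro borel_closed compact_imp_closed compact_sweep compact_scaling compact_voronoi_Int[OF R(1)])
  have "countable N"
    by (rule countable_subset[of _ "L \<times> L"]) (auto simp: N_def \<open>countable L\<close>)
  have null: "(\<Union>p\<in>N. S p) \<in> null_sets lborel"
  proof (rule null_sets_UN'[OF \<open>countable N\<close>])
    fix p assume "p \<in> N"
    then have "hausdorff_measure (DIM(real^'n) - 1) (voronoi L (fst p) \<inter> voronoi L (snd p)) = 0"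
      by (auto simp: N_def nearest_neighbors_def)
    from null_sweep_scaleR[OF this compact_voronoi_Int[OF R(1)], of e h]
    show "S p \<in> null_sets lborel"
      using e by (simp add: null_sets_def S_def[unfolded case_prod_unfold] Sborel[unfolded S_def case_prod_unfold])
  qed
  have sub: "{z \<in> K. (z \<in> W) \<noteq> (z + h \<in> W)} \<subseteq> (\<Union>p\<in>D. S p) \<union> (\<Union>p\<in>N. S p)"
  proof
    fix z assume z: "z \<in> {z \<in> K. (z \<in> W) \<noteq> (z + h \<in> W)}"
    then obtain x y where xy: "x \<in> L" "y \<in> L" "(e *\<^sub>R x \<in> X) \<noteq> (e *\<^sub>R y \<in> X)" "z \<in> S (x, y)"
      using scaled_voronoi_transition[OF clo \<open>L \<noteq> {}\<close> e X, of z h] unfolding W_def S_def by auto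
    then obtain t v where t: "0 \<le> t" "t \<le> 1" "z + t *\<^sub>R h = e *\<^sub>R v" "v \<in> voronoi L x"
      by (auto simp: S_def sweep_def)
    \<comment> \<open>The crossing point is within \<open>e * R\<close> of
      \<open>e *\<^sub>R x\<close> and within \<open>norm h\<close> of \<open>z\<close>. Hence
      \<open>e *\<^sub>R x\<close> lies in the ball of radius \<delta> around \<open>z\<close>, thus
      in \<open>A\<close>, and the energy on \<open>A\<close> sees the pair.\<close>
    have "norm (v - x) \<le> R"
      using voronoi_subset_cball[OF R(1), of x] t(4) by (auto simp: dist_norm norm_minus_commute)
    have "z - e *\<^sub>R x = e *\<^sub>R (v - x) - t *\<^sub>R h"
      using t(3) by (simp add: algebra_simps)
    then have "norm (z - e *\<^sub>R x) \<le> norm (e *\<^sub>R (v - x)) + norm (t *\<^sub>R h)"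
      by (metis norm_triangle_ineq4)
    also have "\<dots> \<le> e * R + norm h"
      using t e \<open>norm (v - x) \<le> R\<close> by (intro add_mono) (auto intro: mult_left_le_one_le)
    finally have "e *\<^sub>R x \<in> cball z \<delta>"
      using \<delta> by (simp add: dist_norm)
    then have "e *\<^sub>R x \<in> A"
      using K[of z] z by auto
    then have "(x, y) \<in> D \<or> (x, y) \<in> N"
      using xy by (auto simp: D_def N_def nn_interface_def)
    with xy show "z \<in> (\<Union>p\<in>D. S p) \<union> (\<Union>p\<in>N. S p)" by auto
  qed
  have UD: "(\<Union>p\<in>D. S p) \<in> sets lborel"
    using fin by (intro sets.finite_UN) auto
  have "emeasure lborel {z \<in> K. (z \<in> W) \<noteq> (z + h \<in> W)}
      \<le> emeasure lborel ((\<Union>p\<in>D. S p) \<union> (\<Union>p\<in>N. S p))"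
    by (intro emeasure_mono sub sets.Un UD null_setsD2[OF null])
  also have "\<dots> = emeasure lborel (\<Union>p\<in>D. S p)"
    by (rule emeasure_Un_null_set[OF UD null])
  also have "\<dots> \<le> (\<Sum>p\<in>D. emeasure lborel (S p))"
    using fin by (intro emeasure_subadditive_finite) auto
  also have "\<dots> \<le> (\<Sum>p\<in>D. ennreal (w * (e * R) ^ (CARD('n) - 1) * (norm h + 2 * (e * R))))"
  proof (rule sum_mono)
    fix p
    have "(\<lambda>z. e *\<^sub>R z) ` (voronoi L (fst p) \<inter> voronoi L (snd p)) \<subseteq> cball (e *\<^sub>R fst p) (e * R)"
    proof
      fix z assume "z \<in> (\<lambda>z. e *\<^sub>R z) ` (voronoi L (fst p) \<inter> voronoi L (snd p))"
      then obtain v where "z = e *\<^sub>R v" "v \<in> cball (fst p) R"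
        using voronoi_subset_cball[OF R(1)] by blast
      then show "z \<in> cball (e *\<^sub>R fst p) (e * R)"
        using e by (simp add: dist_norm flip: scaleR_diff_right)
    qed
    then have "emeasure lborel (S p) \<le> emeasure lborel (sweep h (cball (e *\<^sub>R fst p) (e * R)))"
      unfolding S_def case_prod_unfold by (intro emeasure_mono sweep_mono) simp_all
    also have "\<dots> \<le> ennreal (w * (e * R) ^ (CARD('n) - 1) * (norm h + 2 * (e * R)))"
      using emeasure_sweep_cball_le[of "e * R" h "e *\<^sub>R fst p"] e R by (simp add: w_def)
    finally show "emeasure lborel (S p) \<le> \<dots>" .
  qed
  also have "\<dots> = ennreal (real (card D) * (w * (e * R) ^ (CARD('n) - 1) * (norm h + 2 * (e * R))))"
    using w e R by (simp add: ennreal_of_nat_eq_real_of_nat ennreal_mult)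
  also have "\<dots> \<le> ennreal (w * R ^ (CARD('n) - 1) * (C * M) * (norm h + 2 * (e * R)))"
  proof (rule ennreal_leI)
    \<comment> \<open>The power of \<open>e\<close> in the cross-section of a tube is exactly the
      one that the energy bound on \<open>card D\<close> absorbs.\<close>
    have "real (card D) * (w * (e * R) ^ (CARD('n) - 1) * (norm h + 2 * (e * R)))
      = (w * R ^ (CARD('n) - 1)) * (real (card D) * e ^ (CARD('n) - 1)) * (norm h + 2 * (e * R))"
      by (simp add: power_mult_distrib)
    also have "\<dots> \<le> w * R ^ (CARD('n) - 1) * (C * M) * (norm h + 2 * (e * R))"
      using card w e R by (intro mult_right_mono mult_left_mono) auto
    finally show "real (card D) * (w * (e * R) ^ (CARD('n) - 1) * (norm h + 2 * (e * R))) \<le> \<dots>" .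
  qed
  finally show ?thesis by (simp add: w_def)
qed

section \<open>Compactness from translation estimates\<close>

lemma emeasure_lborel_translate:
  fixes T :: "'a::euclidean_space set"
  assumes "T \<in> sets borel"
  shows "emeasure lborel {h. z + h \<in> T} = emeasure lborel T"
proof -
  have "emeasure lborel T = emeasure (distr lborel borel ((+) z)) T"
    by (simp add: lborel_distr_plus)
  also have "\<dots> = emeasure lborel {h. z + h \<in> T}"
    using assms by (subst emeasure_distr) (auto simp: vimage_def)
  finally show ?thesis by simp
qed

text \<open>The parameter \<open>a\<close> is the error that the lattice spacing adds to the length of \<open>h\<close>.\<close>

definition translation_bound :: "'a::euclidean_space set \<Rightarrow> real \<Rightarrow> real \<Rightarrow> 'a set \<Rightarrow> bool" where
  "translation_bound A M a W \<longleftrightarrow> (\<forall>K \<delta> h. K \<in> sets borel \<longrightarrow> (\<forall>z\<in>K. cball z \<delta> \<subseteq> A) \<longrightarrow> norm h + a \<le> \<delta> \<longrightarrow>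
     emeasure lborel {z \<in> K. (z \<in> W) \<noteq> (z + h \<in> W)} \<le> ennreal (M * (norm h + a)))"

lemma translation_boundD:
  assumes "translation_bound A M a W" "K \<in> sets borel" "\<And>z. z \<in> K \<Longrightarrow> cball z \<delta> \<subseteq> A" "norm h + a \<le> \<delta>"
  shows "emeasure lborel {z \<in> K. (z \<in> W) \<noteq> (z + h \<in> W)} \<le> ennreal (M * (norm h + a))"
  using assms unfolding translation_bound_def by blast

text \<open>With \<open>w = z + h\<close>, Tonelli's theorem turns the left-hand side into an
  integral over \<open>norm h \<le> \<rho>\<close> of the measures of translation differences. Each
  of these is at most \<open>M * (\<rho> + a)\<close>.\<close>

lemma nn_integral_local_deviation_le:
  fixes W :: "'a::euclidean_space set"
  assumes [measurable]: "W \<in> sets borel" "K \<in> sets borel"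
    and tb: "translation_bound A M a W" and K: "\<And>z. z \<in> K \<Longrightarrow> cball z \<delta> \<subseteq> A"
    and \<rho>: "\<rho> + a \<le> \<delta>" "\<rho> \<ge> 0" and "a \<ge> 0" "M \<ge> 0"
  shows "(\<integral>\<^sup>+z. emeasure lborel {w \<in> cball z \<rho>. (w \<in> W) \<noteq> (z \<in> W)} * indicator K z \<partial>lborel)
    \<le> ennreal (unit_ball_vol DIM('a) * \<rho> ^ DIM('a) * (M * (\<rho> + a)))"
proof -
  let ?P = "{p :: 'a \<times> 'a. (fst p + snd p \<in> W) \<noteq> (fst p \<in> W)}"
  let ?f = "\<lambda>z h. indicator ?P (z, h) * indicator (cball 0 \<rho>) h * indicator K z :: ennreal"
  have [measurable]: "?P \<in> sets (borel \<Otimes>\<^sub>M borel)"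
  proof -
    have "{p \<in> space (borel \<Otimes>\<^sub>M borel). (fst p + snd p \<in> W) \<noteq> (fst p \<in> W)} \<in> sets (borel \<Otimes>\<^sub>M borel)"
      by measurable
    then show ?thesis by (simp add: space_pair_measure)
  qed
  have inner: "emeasure lborel {w \<in> cball z \<rho>. (w \<in> W) \<noteq> (z \<in> W)} * indicator K z = (\<integral>\<^sup>+h. ?f z h \<partial>lborel)" for z
  proof -
    have 1: "{w \<in> cball z \<rho>. (w \<in> W) \<noteq> (z \<in> W)} \<in> sets borel" by measurable
    have 2: "{h \<in> cball 0 \<rho>. (z + h \<in> W) \<noteq> (z \<in> W)} \<in> sets lborel" by measurable
    have "emeasure lborel {w \<in> cball z \<rho>. (w \<in> W) \<noteq> (z \<in> W)}
        = emeasure lborel {h \<in> cball 0 \<rho>. (z + h \<in> W) \<noteq> (z \<in> W)}"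
      using emeasure_lborel_translate[OF 1, of z] by (simp add: dist_norm)
    also have "\<dots> * indicator K z
        = (\<integral>\<^sup>+h. indicator {h \<in> cball 0 \<rho>. (z + h \<in> W) \<noteq> (z \<in> W)} h * indicator K z \<partial>lborel)"
      using 2 by (simp add: nn_integral_multc)
    also have "\<dots> = (\<integral>\<^sup>+h. ?f z h \<partial>lborel)"
      by (intro nn_integral_cong) (auto simp: indicator_def)
    finally show ?thesis .
  qed
  have [measurable]: "cball (0::'a) \<rho> \<in> sets borel" by simp
  have "case_prod ?f \<in> borel_measurable (borel \<Otimes>\<^sub>M borel)"
    unfolding case_prod_unfold by measurable
  then have meas: "case_prod ?f \<in> borel_measurable (lborel \<Otimes>\<^sub>M lborel)"
    by (simp add: measurable_cong_sets[OF sets_pair_measure_cong[OF sets_lborel sets_lborel] refl])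
  have "(\<integral>\<^sup>+z. \<integral>\<^sup>+h. ?f z h \<partial>lborel \<partial>lborel) = (\<integral>\<^sup>+h. \<integral>\<^sup>+z. ?f z h \<partial>lborel \<partial>lborel)"
    by (rule lborel_pair.Fubini'[OF meas, symmetric])
  also have "\<dots> \<le> (\<integral>\<^sup>+h. ennreal (M * (\<rho> + a)) * indicator (cball (0::'a) \<rho>) h \<partial>lborel)"
  proof (rule nn_integral_mono)
    fix h :: 'a
    show "(\<integral>\<^sup>+z. ?f z h \<partial>lborel) \<le> ennreal (M * (\<rho> + a)) * indicator (cball 0 \<rho>) h"
    proof (cases "norm h \<le> \<rho>")
      case True
      have "{z \<in> K. (z \<in> W) \<noteq> (z + h \<in> W)} \<in> sets lborel" by measurable
      moreover have "(\<integral>\<^sup>+z. ?f z h \<partial>lborel) = (\<integral>\<^sup>+z. indicator {z \<in> K. (z \<in> W) \<noteq> (z + h \<in> W)} z \<partial>lborel)"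
        using True by (intro nn_integral_cong) (auto simp: indicator_def)
      ultimately have "(\<integral>\<^sup>+z. ?f z h \<partial>lborel) = emeasure lborel {z \<in> K. (z \<in> W) \<noteq> (z + h \<in> W)}"
        by simp
      also have "\<dots> \<le> ennreal (M * (norm h + a))"
        using True \<rho> by (intro translation_boundD[OF tb _ K]) auto
      also have "\<dots> \<le> ennreal (M * (\<rho> + a))"
        using True \<open>M \<ge> 0\<close> by (intro ennreal_leI mult_left_mono) auto
      finally show ?thesis using True by simp
    qed simp
  qed
  also have "\<dots> = ennreal (M * (\<rho> + a)) * ennreal (unit_ball_vol DIM('a) * \<rho> ^ DIM('a))"
    using \<rho> by (simp add: nn_integral_cmult emeasure_cball)
  also have "\<dots> = ennreal (unit_ball_vol DIM('a) * \<rho> ^ DIM('a) * (M * (\<rho> + a)))"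
    using assms by (subst ennreal_mult[symmetric]) (auto simp: mult.commute)
  finally show ?thesis unfolding inner .
qed

text \<open>If \<open>W\<close> looks nearly constant from \<open>z\<close>, then every ball of radius \<open>s\<close> containing \<open>z\<close> decides by
  majority whether \<open>z \<in> W\<close>.\<close>

lemma majority_ball:
  fixes W :: "'a::euclidean_space set"
  assumes [measurable]: "W \<in> sets borel" and z: "z \<in> ball p s"
    and dev: "emeasure lborel {w \<in> cball z (2 * s). (w \<in> W) \<noteq> (z \<in> W)} < ennreal (measure lborel (ball p s) / 2)"
  shows "z \<in> W \<longleftrightarrow> measure lborel (ball p s \<inter> W) > measure lborel (ball p s) / 2"
proof -
  have sub: "ball p s \<subseteq> cball z (2 * s)"
  proof
    fix w assume "w \<in> ball p s"
    then show "w \<in> cball z (2 * s)"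
      using z dist_triangle[of z w p] by (simp add: dist_commute)
  qed
  have fin: "ball p s \<in> fmeasurable lborel"
    using emeasure_lborel_ball_finite[of p s] by (intro fmeasurableI) auto
  have lt: "measure lborel T < measure lborel (ball p s) / 2"
    if "T \<subseteq> {w \<in> ball p s. (w \<in> W) \<noteq> (z \<in> W)}" "T \<in> sets borel" for T
  proof -
    have "{w \<in> cball z (2 * s). (w \<in> W) \<noteq> (z \<in> W)} \<in> sets lborel" by measurable
    then have "emeasure lborel T \<le> emeasure lborel {w \<in> cball z (2 * s). (w \<in> W) \<noteq> (z \<in> W)}"
    proof (rule emeasure_mono[rotated])
      show "T \<subseteq> {w \<in> cball z (2 * s). (w \<in> W) \<noteq> (z \<in> W)}"
      proof
        fix w assume "w \<in> T"
        then have "w \<in> ball p s" "(w \<in> W) \<noteq> (z \<in> W)" using that(1) by auto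
        moreover have "w \<in> cball z (2 * s)" using sub \<open>w \<in> ball p s\<close> by (rule subsetD)
        ultimately show "w \<in> {w \<in> cball z (2 * s). (w \<in> W) \<noteq> (z \<in> W)}" by simp
      qed
    qed
    also note dev
    finally have *: "emeasure lborel T < ennreal (measure lborel (ball p s) / 2)" .
    then have "emeasure lborel T \<noteq> \<infinity>" by auto
    then have "emeasure lborel T = ennreal (measure lborel T)"
      by (intro emeasure_eq_ennreal_measure) auto
    with * show ?thesis by (simp add: ennreal_less_iff)
  qed
  have split: "measure lborel (ball p s) = measure lborel (ball p s \<inter> W) + measure lborel (ball p s - W)"
  proof -
    have "ball p s \<inter> W \<in> fmeasurable lborel" "ball p s - W \<in> fmeasurable lborel"
      using fin by (auto intro!: fmeasurableI2[OF fin])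
    then have "measure lborel ((ball p s \<inter> W) \<union> (ball p s - W))
        = measure lborel (ball p s \<inter> W) + measure lborel (ball p s - W)"
      by (intro measure_Union) (auto simp: fmeasurable_def)
    then show ?thesis by (simp add: Int_Diff_Un)
  qed
  show ?thesis
  proof (cases "z \<in> W")
    case True
    then have "measure lborel (ball p s - W) < measure lborel (ball p s) / 2" by (intro lt) auto
    with True split show ?thesis by simp
  next
    case False
    then have "measure lborel (ball p s \<inter> W) < measure lborel (ball p s) / 2" by (intro lt) auto
    with False show ?thesis by simp
  qed
qed

section \<open>Extraction of subsequences and construction of the limit set\<close>

lemma constant_subsequence:
  fixes f :: "nat \<Rightarrow> 'b"
  assumes "finite (range f)"
  shows "\<exists>r :: nat \<Rightarrow> nat. strict_mono r \<and> (\<forall>j k. f (r j) = f (r k))"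
proof -
  obtain a where "infinite {n. f n = f a}"
    using pigeonhole_infinite[OF infinite_UNIV_nat assms] by auto
  then obtain r :: "nat \<Rightarrow> nat" where "strict_mono r" "\<forall>n. r n \<in> {n. f n = f a}"
    using infinite_enumerate by blast
  then show ?thesis by (intro exI[of _ r]) auto
qed

text \<open>Off a small bad set, \<open>W j\<close> is encoded by the balls of a finite cover in
  which it has the majority. There are finitely many codes, so a subsequence has a constant code;
  two of its members can differ only on their bad sets.\<close>

lemma close_subsequence:
  fixes W :: "nat \<Rightarrow> 'a::euclidean_space set"
  assumes W [measurable]: "\<And>j. W j \<in> sets borel" and K: "compact K" "\<And>z. z \<in> K \<Longrightarrow> cball z \<delta> \<subseteq> A"
    and tb: "\<And>j. translation_bound A M (a j) (W j)" and a: "a \<longlonglongrightarrow> 0" "\<And>j. a j \<ge> 0"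
    and "M \<ge> 0" "\<delta> > 0" "\<eta> > 0"
  obtains r :: "nat \<Rightarrow> nat" where "strict_mono r"
    "\<And>j k. emeasure lborel {z \<in> K. (z \<in> W (r j)) \<noteq> (z \<in> W (r k))} \<le> ennreal \<eta>"
proof -
  have Kb [measurable]: "K \<in> sets borel" using K by (simp add: borel_closed compact_imp_closed)
  \<comment> \<open>The first entry leaves room for the radius \<open>2 * s\<close> plus an error
    \<open>a j \<le> s\<close>. The second makes the Markov bound
    \<open>2 * 2 ^ n * M * (3 * s)\<close> for a bad set at most \<open>\<eta> / 2\<close>, with
    \<open>M + 1\<close> keeping the divisor positive if \<open>M = 0\<close>.\<close>
  define s where "s = min (\<delta> / 3) (\<eta> / (12 * 2 ^ DIM('a) * (M + 1)))"
  have s: "s > 0" "3 * s \<le> \<delta>" "12 * 2 ^ DIM('a) * M * s \<le> \<eta>"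
  proof -
    show "s > 0" "3 * s \<le> \<delta>" using assms by (auto simp: s_def)
    have "12 * 2 ^ DIM('a) * M * s \<le> 12 * 2 ^ DIM('a) * (M + 1) * s"
      using \<open>s > 0\<close> by (intro mult_right_mono mult_left_mono) auto
    also have "\<dots> \<le> 12 * 2 ^ DIM('a) * (M + 1) * (\<eta> / (12 * 2 ^ DIM('a) * (M + 1)))"
      using \<open>M \<ge> 0\<close> by (intro mult_left_mono) (auto simp: s_def)
    also have "\<dots> = \<eta>" using \<open>M \<ge> 0\<close> by simp
    finally show "12 * 2 ^ DIM('a) * M * s \<le> \<eta>" .
  qed
  define \<beta> where "\<beta> = unit_ball_vol DIM('a) * s ^ DIM('a)"
  have \<beta>: "\<beta> > 0" using s by (simp add: \<beta>_def)
  have ball: "measure lborel (ball p s) = \<beta>" for p :: 'a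
    using s by (simp add: content_ball \<beta>_def)
  \<comment> \<open>The bad points: those where the hypothesis of \<open>majority_ball\<close>
    fails, \<beta> being the volume of a ball of radius \<open>s\<close>.\<close>
  define B where "B j = {z \<in> K. emeasure lborel {w \<in> cball z (2 * s). (w \<in> W j) \<noteq> (z \<in> W j)} \<ge> ennreal (\<beta> / 2)}" for j
  have gm: "(\<lambda>z. emeasure lborel {w \<in> cball z (2 * s). (w \<in> W j) \<noteq> (z \<in> W j)}) \<in> borel_measurable borel" for j
  proof -
    have "{p \<in> space (borel \<Otimes>\<^sub>M lborel). dist (fst p) (snd p) \<le> 2 * s \<and> (snd p \<in> W j) \<noteq> (fst p \<in> W j)}
        \<in> sets (borel \<Otimes>\<^sub>M lborel)"
      by measurable
    from lborel.measurable_emeasure_Pair[OF this] show ?thesis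
      by (simp add: space_pair_measure vimage_def)
  qed
  have Bm [measurable]: "B j \<in> sets borel" for j
    unfolding B_def using gm[of j] by measurable
  have Bsmall: "emeasure lborel (B j) \<le> ennreal (\<eta> / 2)" if "a j \<le> s" for j
  proof -
    let ?g = "\<lambda>z. emeasure lborel {w \<in> cball z (2 * s). (w \<in> W j) \<noteq> (z \<in> W j)}"
    have eq: "B j = {z \<in> K. 1 \<le> ennreal (2 / \<beta>) * ?g z}"
    proof -
      have "ennreal (\<beta> / 2) \<le> x \<longleftrightarrow> 1 \<le> ennreal (2 / \<beta>) * x" for x
        using \<beta> by (cases x) (auto simp: ennreal_mult[symmetric] ennreal_mult_top field_simps simp flip: ennreal_1)
      then show ?thesis unfolding B_def by simp
    qed
    have "emeasure lborel (B j) \<le> ennreal (2 / \<beta>) * (\<integral>\<^sup>+z. ?g z * indicator K z \<partial>lborel)"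
      unfolding eq using gm[of j] by (intro nn_integral_Markov_inequality) auto
    also have "\<dots> \<le> ennreal (2 / \<beta>) * ennreal (unit_ball_vol DIM('a) * (2 * s) ^ DIM('a) * (M * (2 * s + a j)))"
      using s a that \<open>M \<ge> 0\<close>
      by (intro mult_left_mono nn_integral_local_deviation_le[OF W Kb tb K(2)]) auto
    also have "\<dots> = ennreal (2 / \<beta> * (\<beta> * (2 ^ DIM('a) * (M * (2 * s + a j)))))"
      using s \<beta> a(2)[of j] \<open>M \<ge> 0\<close>
      by (subst ennreal_mult[symmetric]) (auto simp: \<beta>_def power_mult_distrib mult_ac)
    also have "\<dots> \<le> ennreal (\<eta> / 2)"
    proof (rule ennreal_leI)
      have "2 / \<beta> * (\<beta> * (2 ^ DIM('a) * (M * (2 * s + a j)))) = 2 * 2 ^ DIM('a) * M * (2 * s + a j)"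
        using \<beta> by simp
      also have "\<dots> \<le> 2 * 2 ^ DIM('a) * M * (3 * s)"
        using that \<open>M \<ge> 0\<close> by (intro mult_left_mono) auto
      also have "\<dots> \<le> \<eta> / 2" using s(3) by simp
      finally show "2 / \<beta> * (\<beta> * (2 ^ DIM('a) * (M * (2 * s + a j)))) \<le> \<eta> / 2" .
    qed
    finally show ?thesis .
  qed
  obtain P where P: "finite P" "K \<subseteq> (\<Union>p\<in>P. ball p s)"
    by (rule compactE_image[OF K(1), of K "\<lambda>p. ball p s"]) (use s in auto)
  \<comment> \<open>Finitely many initial terms are dropped so that the measure bound for bad sets
    holds for all remaining ones.\<close>
  obtain J where "\<forall>j\<ge>J. a j < s"
    using order_tendstoD(2)[OF a(1) s(1)] unfolding eventually_sequentially by blast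
  then have J: "a j \<le> s" if "j \<ge> J" for j
    using that by (simp add: less_imp_le)
  define code where "code j = {p \<in> P. measure lborel (ball p s \<inter> W (J + j)) > \<beta> / 2}" for j
  have "finite (range code)"
    by (rule finite_subset[of _ "Pow P"]) (auto simp: code_def P)
  then obtain r :: "nat \<Rightarrow> nat" where r: "strict_mono r" "\<And>j k. code (r j) = code (r k)"
    using constant_subsequence by meson
  show thesis
  proof (rule that[of "\<lambda>j. J + r j"])
    show "strict_mono (\<lambda>j. J + r j)" using r(1) by (simp add: strict_mono_def)
    fix j k
    have dec: "z \<in> W (J + i) \<longleftrightarrow> p \<in> code i" if "z \<in> K - B (J + i)" "z \<in> ball p s" "p \<in> P" for z p i
      using majority_ball[OF W that(2), of "J + i"] that by (auto simp: B_def code_def ball not_le)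
    have sub: "{z \<in> K. (z \<in> W (J + r j)) \<noteq> (z \<in> W (J + r k))} \<subseteq> B (J + r j) \<union> B (J + r k)"
      using P(2) dec[of _ "r j"] dec[of _ "r k"] r(2)[of j k] by blast
    have "emeasure lborel {z \<in> K. (z \<in> W (J + r j)) \<noteq> (z \<in> W (J + r k))}
        \<le> emeasure lborel (B (J + r j) \<union> B (J + r k))"
      by (intro emeasure_mono sub) auto
    also have "\<dots> \<le> emeasure lborel (B (J + r j)) + emeasure lborel (B (J + r k))"
      by (intro emeasure_subadditive) auto
    also have "\<dots> \<le> ennreal (\<eta> / 2) + ennreal (\<eta> / 2)"
      by (intro add_mono Bsmall J) auto
    also have "\<dots> = ennreal \<eta>" using \<open>\<eta> > 0\<close> by (simp flip: ennreal_plus)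
    finally show "emeasure lborel {z \<in> K. (z \<in> W (J + r j)) \<noteq> (z \<in> W (J + r k))} \<le> ennreal \<eta>" .
  qed
qed

text \<open>The property that \<open>P m\<close> holds between all members of a sequence passes to
  subsequences, as the locale \<open>subseqs\<close> requires. The diagonal sequence is a
  subsequence of the one selected at stage \<open>m\<close> from index \<open>Suc m\<close> on,
  whence the strict inequalities.\<close>

lemma diagonal_subsequence:
  fixes P :: "nat \<Rightarrow> nat \<Rightarrow> nat \<Rightarrow> bool"
  assumes step: "\<And>m s. strict_mono (s :: nat \<Rightarrow> nat) \<Longrightarrow> \<exists>r :: nat \<Rightarrow> nat. strict_mono r \<and> (\<forall>j k. P m (s (r j)) (s (r k)))"
  shows "\<exists>\<sigma> :: nat \<Rightarrow> nat. strict_mono \<sigma> \<and> (\<forall>m j k. m < j \<longrightarrow> m < k \<longrightarrow> P m (\<sigma> j) (\<sigma> k))"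
proof -
  interpret subseqs "\<lambda>m s. \<forall>j k. P m (s j) (s k)"
    by unfold_locales (unfold o_def, rule step)
  have "\<forall>j k. P m ((diagseq \<circ> ((+) (Suc m))) j) ((diagseq \<circ> ((+) (Suc m))) k)" for m
    by (rule diagseq_holds) simp
  then have *: "P m (diagseq (Suc m + (j - Suc m))) (diagseq (Suc m + (k - Suc m)))" for m j k
    by simp
  have "P m (diagseq j) (diagseq k)" if "m < j" "m < k" for m j k
  proof -
    have "Suc m + (j - Suc m) = j" "Suc m + (k - Suc m) = k" using that by auto
    then show ?thesis using *[of m j k] by (simp only:)
  qed
  with subseq_diagseq show ?thesis by blast
qed

text \<open>If \<open>Q\<close> never changed from \<open>j\<close> on, then \<open>Q j\<close>
  would agree with \<open>Q\<close> holding infinitely often. This reduces a comparison with the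
  limes superior to comparisons of consecutive sets.\<close>

lemma eventually_switch:
  fixes Q :: "nat \<Rightarrow> bool"
  assumes "Q j \<noteq> (\<forall>n. \<exists>i\<ge>n. Q i)"
  obtains i where "i \<ge> j" "Q i \<noteq> Q (Suc i)"
proof -
  have False if const: "\<And>i. i \<ge> j \<Longrightarrow> Q i = Q (Suc i)"
  proof -
    have eq: "Q i = Q j" if "i \<ge> j" for i
      using that by (induction i rule: dec_induct) (simp_all add: const[symmetric])
    have "\<exists>i\<ge>n. Q i" if "Q j" for n
      using that eq[of "max n j"] by (intro exI[of _ "max n j"]) auto
    then show False using assms eq by blast
  qed
  with that show thesis by blast
qed

text \<open>Along an exhaustion of \<open>A\<close> by compact sets \<open>C m\<close>, stage
  \<open>m\<close> selects a subsequence whose members differ on \<open>C m\<close> by measure at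
  most \<open>(1/2) ^ m\<close>. The diagonal sequence then converges on every compact
  subset.\<close>

lemma compactness_translation_bound:
  fixes W :: "nat \<Rightarrow> 'a::euclidean_space set"
  assumes W [measurable]: "\<And>j. W j \<in> sets borel" and A: "open A"
    and tb: "\<And>j. translation_bound A M (a j) (W j)" and a: "a \<longlonglongrightarrow> 0" "\<And>j. a j \<ge> 0"
    and "M \<ge> 0"
  obtains V and \<sigma> :: "nat \<Rightarrow> nat" where "V \<in> sets borel" "V \<subseteq> A" "strict_mono \<sigma>"
    "\<And>K. compact K \<Longrightarrow> K \<subseteq> A \<Longrightarrow> (\<lambda>j. emeasure lborel {z \<in> K. (z \<in> W (\<sigma> j)) \<noteq> (z \<in> V)}) \<longlonglongrightarrow> 0"
proof -
  obtain C :: "nat \<Rightarrow> 'a set" where C: "\<And>n. compact (C n)" "\<And>n. C n \<subseteq> A"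
    "\<And>n. C n \<subseteq> interior (C (Suc n))" "\<Union>(range C) = A" "\<And>K. \<lbrakk>compact K; K \<subseteq> A\<rbrakk> \<Longrightarrow> \<exists>N. \<forall>n\<ge>N. K \<subseteq> C n"
    using open_Union_compact_subsets[OF A] by metis
  have Cb [measurable]: "C n \<in> sets borel" for n using C by (simp add: borel_closed compact_imp_closed)
  define P where "P m j k \<longleftrightarrow> emeasure lborel {z \<in> C m. (z \<in> W j) \<noteq> (z \<in> W k)} \<le> ennreal ((1/2) ^ m)" for m j k
  have "\<exists>\<sigma> :: nat \<Rightarrow> nat. strict_mono \<sigma> \<and> (\<forall>m j k. m < j \<longrightarrow> m < k \<longrightarrow> P m (\<sigma> j) (\<sigma> k))"
  proof (rule diagonal_subsequence[of P])
    fix m and s :: "nat \<Rightarrow> nat" assume s: "strict_mono s"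
    obtain \<delta> where \<delta>: "\<delta> > 0" "(\<Union>z\<in>C m. cball z \<delta>) \<subseteq> A"
      using compact_subset_open_imp_cball_epsilon_subset[OF C(1) A C(2)] by blast
    have "(a \<circ> s) \<longlonglongrightarrow> 0" using a(1) s by (rule LIMSEQ_subseq_LIMSEQ)
    then obtain r :: "nat \<Rightarrow> nat" where "strict_mono r"
      "\<And>j k. emeasure lborel {z \<in> C m. (z \<in> W (s (r j))) \<noteq> (z \<in> W (s (r k)))} \<le> ennreal ((1/2) ^ m)"
      using close_subsequence[of "\<lambda>j. W (s j)" "C m" \<delta> A M "a \<circ> s" "(1/2) ^ m"] \<delta> C(1) tb a(2) \<open>M \<ge> 0\<close>
      by (auto simp: UN_subset_iff)
    then show "\<exists>r :: nat \<Rightarrow> nat. strict_mono r \<and> (\<forall>j k. P m (s (r j)) (s (r k)))" by (auto simp: P_def)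
  qed
  then obtain \<sigma> :: "nat \<Rightarrow> nat"
    where \<sigma>: "strict_mono \<sigma>" "\<And>m j k. m < j \<Longrightarrow> m < k \<Longrightarrow> P m (\<sigma> j) (\<sigma> k)"
    by blast
  \<comment> \<open>A point where \<open>W (\<sigma> j)\<close> differs from the limes superior lies in some \<open>E i\<close> below, and the
    measures of these sets are summable.\<close>
  define V where "V = {z \<in> A. \<forall>n. \<exists>i\<ge>n. z \<in> W (\<sigma> i)}"
  have [measurable]: "A \<in> sets borel" using A by simp
  show thesis
  proof (rule that[of V \<sigma>])
    show "V \<in> sets borel" unfolding V_def by measurable
    show "V \<subseteq> A" by (auto simp: V_def)
    show "strict_mono \<sigma>" by fact
    fix K assume K: "compact K" "K \<subseteq> A"
    then obtain N where N: "\<And>n. n \<ge> N \<Longrightarrow> K \<subseteq> C n" using C(5) by blast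
    have bound: "emeasure lborel {z \<in> K. (z \<in> W (\<sigma> j)) \<noteq> (z \<in> V)} \<le> ennreal (4 * (1/2) ^ j)"
      if j: "j \<ge> Suc N" for j
    proof -
      \<comment> \<open>To compare the terms \<open>j + i\<close> and \<open>j + i + 1\<close>, the
        diagonal property needs a stage strictly below both, and \<open>j + i - 1\<close> is the
        largest. Since \<open>j \<ge> Suc N\<close>, the subtraction is not truncated and
        \<open>K\<close> lies in the corresponding compact set.\<close>
      define E where "E i = {z \<in> C (j + i - 1). (z \<in> W (\<sigma> (j + i))) \<noteq> (z \<in> W (\<sigma> (Suc (j + i))))}" for i
      have Em: "E i \<in> sets lborel" for i unfolding E_def by measurable
      have sub: "{z \<in> K. (z \<in> W (\<sigma> j)) \<noteq> (z \<in> V)} \<subseteq> (\<Union>i. E i)"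
      proof
        fix z assume z: "z \<in> {z \<in> K. (z \<in> W (\<sigma> j)) \<noteq> (z \<in> V)}"
        then have "(z \<in> W (\<sigma> j)) \<noteq> (\<forall>n. \<exists>i\<ge>n. z \<in> W (\<sigma> i))" using K by (auto simp: V_def)
        then obtain i where i: "i \<ge> j" "(z \<in> W (\<sigma> i)) \<noteq> (z \<in> W (\<sigma> (Suc i)))"
          by (rule eventually_switch)
        have "N \<le> i - 1" using i(1) j by linarith
        then have "z \<in> C (i - 1)" using N z by blast
        then have "z \<in> E (i - j)" using i by (simp add: E_def)
        then show "z \<in> (\<Union>i. E i)" by blast
      qed
      have "emeasure lborel {z \<in> K. (z \<in> W (\<sigma> j)) \<noteq> (z \<in> V)} \<le> emeasure lborel (\<Union>i. E i)"
        using Em by (intro emeasure_mono sub) auto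
      also have "\<dots> \<le> (\<Sum>i. emeasure lborel (E i))"
        using Em by (intro emeasure_subadditive_countably) auto
      also have "\<dots> \<le> (\<Sum>i. ennreal (2 * (1/2) ^ j * (1/2) ^ i))"
      proof (intro suminf_le summableI)
        fix i
        have "emeasure lborel (E i) \<le> ennreal ((1/2) ^ (j + i - 1))"
          using \<sigma>(2)[of "j + i - 1" "j + i" "Suc (j + i)"] j by (simp add: P_def E_def)
        also have "(1/2::real) ^ (j + i - 1) = 2 * (1/2) ^ j * (1/2) ^ i"
          using j by (cases j) (auto simp: power_add)
        finally show "emeasure lborel (E i) \<le> ennreal (2 * (1/2) ^ j * (1/2) ^ i)" .
      qed
      also have "\<dots> = ennreal (\<Sum>i. 2 * (1/2) ^ j * (1/2) ^ i)"
        by (intro suminf_ennreal2 summable_mult summable_geometric) auto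
      also have "(\<Sum>i. 2 * (1/2::real) ^ j * (1/2) ^ i) = 4 * (1/2) ^ j"
        by (subst suminf_mult) (auto simp: suminf_geometric)
      finally show ?thesis .
    qed
    have "(\<lambda>j. ennreal (4 * (1/2) ^ j)) \<longlonglongrightarrow> ennreal (4 * 0)"
      by (intro tendsto_ennrealI tendsto_mult tendsto_const LIMSEQ_power_zero) auto
    then have lim: "(\<lambda>j. ennreal (4 * (1/2) ^ j)) \<longlonglongrightarrow> 0" by simp
    show "(\<lambda>j. emeasure lborel {z \<in> K. (z \<in> W (\<sigma> j)) \<noteq> (z \<in> V)}) \<longlonglongrightarrow> 0"
    proof (rule tendsto_sandwich[OF _ _ tendsto_const lim])
      show "\<forall>\<^sub>F j in sequentially. 0 \<le> emeasure lborel {z \<in> K. (z \<in> W (\<sigma> j)) \<noteq> (z \<in> V)}"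
        by simp
      show "\<forall>\<^sub>F j in sequentially. emeasure lborel {z \<in> K. (z \<in> W (\<sigma> j)) \<noteq> (z \<in> V)}
          \<le> ennreal (4 * (1/2) ^ j)"
        using bound by (rule eventually_sequentiallyI)
    qed
  qed
qed

section \<open>Perimeter from translation estimates\<close>

text \<open>If \<open>V\<close> separates \<open>z\<close> from \<open>z + h\<close>, then
  \<open>W j\<close> separates them, or \<open>W j\<close> and \<open>V\<close> disagree at
  \<open>z\<close> or at \<open>z + h\<close>. The two disagreements vanish in the limit, and
  \<open>norm h < \<delta>\<close> leaves room for the error \<open>a j\<close> once
  \<open>j\<close> is large.\<close>

lemma translation_bound_limit:
  fixes W :: "nat \<Rightarrow> 'a::euclidean_space set"
  assumes W [measurable]: "\<And>j. W j \<in> sets borel" and V [measurable]: "V \<in> sets borel"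
    and tb: "\<And>j. translation_bound A M (a j) (W j)" and a: "a \<longlonglongrightarrow> 0" "\<And>j. a j \<ge> 0"
    and conv: "\<And>K. compact K \<Longrightarrow> K \<subseteq> A \<Longrightarrow>
      (\<lambda>j. emeasure lborel {z \<in> K. (z \<in> W j) \<noteq> (z \<in> V)}) \<longlonglongrightarrow> 0"
    and K: "compact K" "\<And>z. z \<in> K \<Longrightarrow> cball z \<delta> \<subseteq> A" and h: "norm h < \<delta>"
  shows "emeasure lborel {z \<in> K. (z \<in> V) \<noteq> (z + h \<in> V)} \<le> ennreal (M * norm h)"
proof -
  have Kb [measurable]: "K \<in> sets borel" using K by (simp add: borel_closed compact_imp_closed)
  \<comment> \<open>The points \<open>z + h\<close> range over this set. It is compact and contained
    in \<open>A\<close>, so the convergence hypothesis applies to it as well.\<close>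
  define K' where "K' = (+) h ` K"
  have K': "compact K'" unfolding K'_def by (rule compact_translation) (rule K(1))
  have K'b [measurable]: "K' \<in> sets borel" using K' by (simp add: borel_closed compact_imp_closed)
  have "\<delta> \<ge> 0" using h norm_ge_zero[of h] by linarith
  have KA: "K \<subseteq> A" using K(2) \<open>\<delta> \<ge> 0\<close> by fastforce
  have K'A: "K' \<subseteq> A"
  proof
    fix w assume "w \<in> K'"
    then obtain z where "z \<in> K" "w = h + z" by (auto simp: K'_def)
    then have "w \<in> cball z \<delta>" using h by (simp add: dist_norm)
    then show "w \<in> A" using K(2)[OF \<open>z \<in> K\<close>] by blast
  qed
  let ?e = "\<lambda>K j. emeasure lborel {z \<in> K. (z \<in> W j) \<noteq> (z \<in> V)}"
  have le: "emeasure lborel {z \<in> K. (z \<in> V) \<noteq> (z + h \<in> V)} \<le> ennreal (M * (norm h + a j)) + ?e K j + ?e K' j"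
    if "norm h + a j \<le> \<delta>" for j
  proof -
    let ?S1 = "{z \<in> K. (z \<in> W j) \<noteq> (z + h \<in> W j)}"
    let ?S2 = "{z \<in> K. (z \<in> W j) \<noteq> (z \<in> V)}"
    let ?S3 = "{z. h + z \<in> {w \<in> K'. (w \<in> W j) \<noteq> (w \<in> V)}}"
    have m: "?S1 \<in> sets lborel" "?S2 \<in> sets lborel" "?S3 \<in> sets lborel"
      by measurable
    have "emeasure lborel {z \<in> K. (z \<in> V) \<noteq> (z + h \<in> V)} \<le> emeasure lborel (?S1 \<union> ?S2 \<union> ?S3)"
    proof (rule emeasure_mono)
      show "{z \<in> K. (z \<in> V) \<noteq> (z + h \<in> V)} \<subseteq> ?S1 \<union> ?S2 \<union> ?S3"
        by (auto simp: K'_def add.commute)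
    qed (use m in auto)
    also have "\<dots> \<le> emeasure lborel (?S1 \<union> ?S2) + emeasure lborel ?S3"
      using m by (intro emeasure_subadditive) auto
    also have "emeasure lborel (?S1 \<union> ?S2) \<le> emeasure lborel ?S1 + emeasure lborel ?S2"
      using m by (intro emeasure_subadditive) auto
    also have "emeasure lborel ?S1 \<le> ennreal (M * (norm h + a j))"
      using that by (intro translation_boundD[OF tb Kb K(2)]) auto
    also have "emeasure lborel ?S3 = ?e K' j"
      by (rule emeasure_lborel_translate) measurable
    finally show ?thesis by (simp add: add_mono)
  qed
  have "(\<lambda>j. ennreal (M * (norm h + a j)) + ?e K j + ?e K' j) \<longlonglongrightarrow> ennreal (M * (norm h + 0)) + 0 + 0"
    by (intro tendsto_add conv K K' KA K'A tendsto_ennrealI tendsto_mult tendsto_const a)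
  moreover have "\<forall>\<^sub>F j in sequentially. emeasure lborel {z \<in> K. (z \<in> V) \<noteq> (z + h \<in> V)}
      \<le> ennreal (M * (norm h + a j)) + ?e K j + ?e K' j"
  proof (rule eventually_mono)
    show "\<forall>\<^sub>F j in sequentially. a j < \<delta> - norm h"
      using order_tendstoD(2)[OF a(1)] h by simp
    fix j assume "a j < \<delta> - norm h"
    then show "emeasure lborel {z \<in> K. (z \<in> V) \<noteq> (z + h \<in> V)} \<le> ennreal (M * (norm h + a j)) + ?e K j + ?e K' j"
      by (intro le) linarith
  qed
  ultimately have "emeasure lborel {z \<in> K. (z \<in> V) \<noteq> (z + h \<in> V)} \<le> ennreal (M * (norm h + 0)) + 0 + 0"
    by (rule tendsto_lowerbound) simp
  then show ?thesis by simp
qed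

section \<open>Difference quotients and the perimeter bound\<close>

lemma integral_lborel_translate:
  fixes f :: "'a::euclidean_space \<Rightarrow> real"
  assumes "f \<in> borel_measurable borel"
  shows "(\<integral>x. f (c + x) \<partial>lborel) = (\<integral>x. f x \<partial>lborel)"
proof -
  have "(\<integral>x. f x \<partial>lborel) = (\<integral>x. f x \<partial>distr lborel borel ((+) c))"
    by (simp add: lborel_distr_plus)
  also have "\<dots> = (\<integral>x. f (c + x) \<partial>lborel)"
    using assms by (intro integral_distr) auto
  finally show ?thesis by simp
qed

lemma difference_quotient_LIMSEQ:
  fixes f :: "'a::real_normed_vector \<Rightarrow> real"
  assumes "(f has_derivative f') (at x)"
  shows "(\<lambda>k. (f (x + (1 / real (Suc k)) *\<^sub>R e) - f x) / (1 / real (Suc k))) \<longlonglongrightarrow> f' e"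
proof -
  have line: "((\<lambda>t. x + t *\<^sub>R e) has_derivative (\<lambda>t. t *\<^sub>R e)) (at 0)"
    by (auto intro!: derivative_eq_intros)
  have "((\<lambda>t. f (x + t *\<^sub>R e)) has_derivative (\<lambda>t. f' (t *\<^sub>R e))) (at 0)"
    using has_derivative_compose[OF line, of f f'] assms by simp
  moreover have "f' (t *\<^sub>R e) = f' e * t" for t
    using has_derivative_linear[OF assms] by (simp add: linear_cmul)
  ultimately have "((\<lambda>t. f (x + t *\<^sub>R e)) has_field_derivative f' e) (at 0)"
    by (simp add: has_field_derivative_def)
  then have lim: "((\<lambda>t. (f (x + t *\<^sub>R e) - f x) / t) \<longlongrightarrow> f' e) (at 0)"
    by (simp add: DERIV_def)
  have "filterlim (\<lambda>k. 1 / real (Suc k)) (at 0) sequentially"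
    unfolding filterlim_at using LIMSEQ_Suc[OF lim_inverse_n'] by auto
  from filterlim_compose[OF lim this] show ?thesis .
qed

text \<open>A discrete integration by parts: a change of variables moves the translation from
  \<open>f\<close> to \<open>V\<close>. The two indicators then differ, within \<open>K\<close>,
  only on a set of measure at most \<open>m * t\<close>, and division by \<open>t\<close> leaves
  \<open>m\<close>.\<close>

lemma integral_difference_quotient_le:
  fixes V :: "'a::euclidean_space set" and f :: "'a \<Rightarrow> real"
  assumes V [measurable]: "V \<in> sets borel" and f: "continuous_on UNIV f" "\<And>x. \<bar>f x\<bar> \<le> indicator K x"
    and K: "compact K" and t: "t > 0" and m: "m \<ge> 0"
    and V_le: "emeasure lborel {z \<in> K. (z \<in> V) \<noteq> (z + (- t) *\<^sub>R e \<in> V)} \<le> ennreal (m * t)"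
  shows "(\<integral>x. indicator V x * ((f (x + t *\<^sub>R e) - f x) / t) \<partial>lborel) \<le> m"
proof -
  have Kb [measurable]: "K \<in> sets borel" using K by (simp add: borel_closed compact_imp_closed)
  have fb [measurable]: "f \<in> borel_measurable borel" using f(1) by (rule borel_measurable_continuous_onI)
  have Kfin: "emeasure lborel K < \<infinity>" using emeasure_compact_finite[OF K] by simp
  have int: "integrable lborel (\<lambda>x. indicator T x * f x)" if [measurable]: "T \<in> sets borel" for T
  proof (rule Bochner_Integration.integrable_bound)
    show "integrable lborel (indicator K :: 'a \<Rightarrow> real)" using Kfin by simp
    show "AE x in lborel. norm (indicator T x * f x) \<le> norm (indicator K x :: real)"
    proof (intro AE_I2)
      fix x show "norm (indicator T x * f x) \<le> norm (indicator K x :: real)"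
        using f(2)[of x] by (auto simp: indicator_def split: if_splits)
    qed
  qed measurable
  \<comment> \<open>This is \<open>V\<close> translated by \<open>t *\<^sub>R e\<close>.\<close>
  define T where "T = {x. x + (- t) *\<^sub>R e \<in> V}"
  have T [measurable]: "T \<in> sets borel" unfolding T_def by measurable
  have shift: "(\<lambda>x. indicator T (t *\<^sub>R e + x) * f (t *\<^sub>R e + x)) = (\<lambda>x. indicator V x * f (x + t *\<^sub>R e))"
    by (auto simp: T_def indicator_def add.commute)
  have int': "integrable lborel (\<lambda>x. indicator V x * f (x + t *\<^sub>R e))"
  proof -
    have "integrable (distr lborel borel ((+) (t *\<^sub>R e))) (\<lambda>x. indicator T x * f x)"
      using int[OF T] by (simp add: lborel_distr_plus)
    then have "integrable lborel (\<lambda>x. indicator T (t *\<^sub>R e + x) * f (t *\<^sub>R e + x))"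
      by (subst (asm) integrable_distr_eq) measurable
    then show ?thesis by (simp only: shift)
  qed
  have "(\<integral>x. indicator V x * ((f (x + t *\<^sub>R e) - f x) / t) \<partial>lborel)
      = (\<integral>x. (indicator V x * f (x + t *\<^sub>R e) - indicator V x * f x) / t \<partial>lborel)"
    by (intro Bochner_Integration.integral_cong) (auto simp: right_diff_distrib diff_divide_distrib)
  also have "\<dots> = ((\<integral>x. indicator V x * f (x + t *\<^sub>R e) \<partial>lborel) - (\<integral>x. indicator V x * f x \<partial>lborel)) / t"
    using int int' by simp
  also have "(\<integral>x. indicator V x * f (x + t *\<^sub>R e) \<partial>lborel) = (\<integral>x. indicator T x * f x \<partial>lborel)"
    using integral_lborel_translate[of "\<lambda>x. indicator T x * f x" "t *\<^sub>R e"] by (simp add: shift)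
  also have "(\<integral>x. indicator T x * f x \<partial>lborel) - (\<integral>x. indicator V x * f x \<partial>lborel)
      = (\<integral>x. indicator T x * f x - indicator V x * f x \<partial>lborel)"
    using int by simp
  also have "(\<integral>x. indicator T x * f x - indicator V x * f x \<partial>lborel) \<le> m * t"
  proof -
    let ?S = "{z \<in> K. (z \<in> V) \<noteq> (z + (- t) *\<^sub>R e \<in> V)}"
    have S: "?S \<in> sets lborel" by measurable
    have Sfin: "emeasure lborel ?S < \<infinity>" using V_le by (simp add: order_le_less_trans)
    have "(\<integral>x. indicator T x * f x - indicator V x * f x \<partial>lborel) \<le> (\<integral>x. indicator ?S x \<partial>lborel)"
    proof (rule integral_mono)
      show "integrable lborel (\<lambda>x. indicator T x * f x - indicator V x * f x)" using int by simp
      show "integrable lborel (indicator ?S :: 'a \<Rightarrow> real)" using S Sfin by simp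
      fix x show "indicator T x * f x - indicator V x * f x \<le> indicator ?S x"
        using f(2)[of x] by (auto simp: T_def indicator_def split: if_splits)
    qed
    also have "\<dots> = measure lborel ?S" using S Sfin by simp
    also have "\<dots> \<le> m * t"
      using V_le t m by (simp add: measure_def enn2real_leI)
    finally show ?thesis .
  qed
  finally show ?thesis using t by (simp add: field_simps)
qed

text \<open>Each partial derivative in the divergence is a limit of difference quotients whose
  integrals over \<open>V\<close> are eventually at most \<open>m\<close>. Dominated convergence
  carries this bound to the limit, and the sum has one term for each coordinate.\<close>

lemma perimeter_le:
  fixes V A :: "(real^'n) set" and m :: real
  assumes V [measurable]: "V \<in> sets borel" and A: "open A" and m: "m \<ge> 0"
    and V_le: "\<And>K \<delta> h. compact K \<Longrightarrow> (\<And>z. z \<in> K \<Longrightarrow> cball z \<delta> \<subseteq> A) \<Longrightarrow> norm h < \<delta> \<Longrightarrow>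
      emeasure lborel {z \<in> K. (z \<in> V) \<noteq> (z + h \<in> V)} \<le> ennreal (m * norm h)"
  shows "perimeter V A \<le> ereal (CARD('n) * m)"
  unfolding perimeter_def
proof (rule SUP_least)
  fix \<phi> assume "\<phi> \<in> {\<phi> \<in> C1_compactly_supported A. \<forall>x. norm (\<phi> x) \<le> 1}"
  then obtain \<phi>' :: "real^'n \<Rightarrow> (real^'n) \<Rightarrow>\<^sub>L (real^'n)" where
    c\<phi>': "continuous_on UNIV \<phi>'" and d\<phi>: "\<And>x. (\<phi> has_derivative blinfun_apply (\<phi>' x)) (at x)"
    and K: "compact (closure {x. \<phi> x \<noteq> 0})" "closure {x. \<phi> x \<noteq> 0} \<subseteq> A" and n\<phi>: "\<And>x. norm (\<phi> x) \<le> 1"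
    by (auto simp: C1_compactly_supported_def)
  define K where "K = closure {x. \<phi> x \<noteq> 0}"
  have zero: "\<phi> x = 0" if "x \<notin> K" for x
    using that closure_subset[of "{x. \<phi> x \<noteq> 0}"] by (auto simp: K_def)
  note K = K[folded K_def]
  \<comment> \<open>The steps of the difference quotients have length at most 1, so all quotients
    vanish outside this enlargement of the support. It carries the integrable majorant.\<close>
  define K1 where "K1 = {x + y |x y. x \<in> K \<and> y \<in> cball 0 1}"
  have K1: "compact K1" unfolding K1_def by (intro compact_sums K compact_cball)
  have K1b [measurable]: "K1 \<in> sets borel" using K1 by (simp add: borel_closed compact_imp_closed)
  have KK1: "x \<in> K1" if "x + h \<in> K" "norm h \<le> 1" for x h
    unfolding K1_def using that by (intro CollectI exI[of _ "x + h"] exI[of _ "- h"]) auto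
  obtain \<rho> where \<rho>: "K1 \<subseteq> cball 0 \<rho>"
    using compact_imp_bounded[OF K1] unfolding bounded_iff by (auto simp: subset_iff)
  \<comment> \<open>The ball is convex and contains \<open>x\<close> and
    \<open>x + t *\<^sub>R axis i 1\<close> for every \<open>x\<close> in \<open>K1\<close> and
    \<open>t \<le> 1\<close>, as the mean value inequality requires.\<close>
  obtain B where B: "\<And>x. x \<in> cball 0 (\<rho> + 1) \<Longrightarrow> norm (\<phi>' x) \<le> B"
  proof -
    have "bounded (\<phi>' ` cball 0 (\<rho> + 1))"
      using c\<phi>' by (intro compact_imp_bounded compact_continuous_image) (auto intro: continuous_on_subset)
    then obtain b where "\<forall>y\<in>\<phi>' ` cball 0 (\<rho> + 1). norm y \<le> b"
      unfolding bounded_iff by blast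
    then show ?thesis by (intro that[of b]) blast
  qed
  have c\<phi>: "continuous_on UNIV \<phi>"
    using d\<phi> by (meson continuous_at_imp_continuous_on has_derivative_continuous)
  define D where "D i x = \<phi>' x (axis i 1) $ i" for i x
  have div: "divergence \<phi> x = (\<Sum>i\<in>UNIV. D i x)" for x
    using frechet_derivative_at[OF d\<phi>[of x]] by (simp add: divergence_def D_def)
  have Dc: "continuous_on UNIV (D i)" for i
    unfolding D_def by (intro continuous_intros c\<phi>')
  have Dm [measurable]: "D i \<in> borel_measurable borel" for i
    using Dc by (rule borel_measurable_continuous_onI)
  define q where "q i k x = (\<phi> (x + (1 / real (Suc k)) *\<^sub>R axis i 1) $ i - \<phi> x $ i) / (1 / real (Suc k))" for i k x
  have \<phi>m [measurable]: "(\<lambda>x. \<phi> x $ i) \<in> borel_measurable borel" for i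
    by (intro borel_measurable_continuous_onI continuous_intros c\<phi>)
  have qm [measurable]: "q i k \<in> borel_measurable borel" for i k
    unfolding q_def by measurable
  have q_lim: "(\<lambda>k. q i k x) \<longlonglongrightarrow> D i x" for i x
    unfolding q_def D_def
    by (rule difference_quotient_LIMSEQ) (rule bounded_linear.has_derivative[OF bounded_linear_vec_nth d\<phi>])
  have q_bd: "\<bar>q i k x\<bar> \<le> B * indicator K1 x" for i k x
  proof -
    define t where "t = 1 / real (Suc k)"
    have t: "t > 0" "t \<le> 1" by (auto simp: t_def)
    have qt: "q i k x = (\<phi> (x + t *\<^sub>R axis i 1) $ i - \<phi> x $ i) / t" by (simp only: q_def t_def)
    show ?thesis
    proof (cases "x \<in> K1")
      case False
      then have "x \<notin> K" "x + t *\<^sub>R axis i 1 \<notin> K"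
        using KK1[of x 0] KK1[of x "t *\<^sub>R axis i 1"] t by auto
      then show ?thesis using False by (simp add: qt zero)
    next
      case True
      then have "norm x \<le> \<rho>" using \<rho> by auto
      then have x: "x \<in> cball 0 (\<rho> + 1)" by simp
      have "norm (x + t *\<^sub>R axis i 1) \<le> norm x + t"
        using t norm_triangle_ineq[of x "t *\<^sub>R axis i 1"] by simp
      then have y: "x + t *\<^sub>R axis i 1 \<in> cball 0 (\<rho> + 1)" using \<open>norm x \<le> \<rho>\<close> t by simp
      have "norm (\<phi> (x + t *\<^sub>R axis i 1) - \<phi> x) \<le> B * norm ((x + t *\<^sub>R axis i 1) - x)"
      proof (rule differentiable_bound[OF convex_cball _ _ y x])
        fix z :: "real^'n" assume "z \<in> cball 0 (\<rho> + 1)"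
        then show "onorm (blinfun_apply (\<phi>' z)) \<le> B" using B by (simp add: norm_blinfun.rep_eq)
        show "(\<phi> has_derivative blinfun_apply (\<phi>' z)) (at z within cball 0 (\<rho> + 1))"
          by (rule has_derivative_at_withinI[OF d\<phi>])
      qed
      then have "\<bar>(\<phi> (x + t *\<^sub>R axis i 1) - \<phi> x) $ i\<bar> \<le> B * t"
        using component_le_norm_cart[of "\<phi> (x + t *\<^sub>R axis i 1) - \<phi> x" i] t by simp
      then have "\<bar>\<phi> (x + t *\<^sub>R axis i 1) $ i - \<phi> x $ i\<bar> / t \<le> B"
        using t by (simp add: pos_divide_le_eq)
      then show ?thesis using True t by (simp add: qt)
    qed
  qed
  have dom: "integrable lborel (\<lambda>x. B * indicator K1 x)"
    using K1 emeasure_compact_finite[OF K1] by simp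
  have bd: "AE x in lborel. norm (indicator V x * q i k x) \<le> B * indicator K1 x" for i k
  proof (intro AE_I2)
    fix x show "norm (indicator V x * q i k x) \<le> B * indicator K1 x"
      using q_bd[of i k x] by (auto simp: indicator_def split: if_splits)
  qed
  have lim: "AE x in lborel. (\<lambda>k. indicator V x * q i k x) \<longlonglongrightarrow> indicator V x * D i x" for i
    by (intro AE_I2 tendsto_mult tendsto_const q_lim)
  have meas: "(\<lambda>x. indicator V x * q i k x) \<in> borel_measurable lborel"
    "(\<lambda>x. indicator V x * D i x) \<in> borel_measurable lborel" for i k
    by measurable
  have D_int: "integrable lborel (\<lambda>x. indicator V x * D i x)" for i
    by (rule integrable_dominated_convergence[OF meas(2) meas(1) dom lim bd])
  have D_le: "(\<integral>x. indicator V x * D i x \<partial>lborel) \<le> m" for i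
  proof -
    obtain \<delta> where \<delta>: "\<delta> > 0" "(\<Union>z\<in>K. cball z \<delta>) \<subseteq> A"
      using compact_subset_open_imp_cball_epsilon_subset[OF K(1) A K(2)] by blast
    have small: "(\<lambda>k. 1 / real (Suc k)) \<longlonglongrightarrow> 0" using LIMSEQ_Suc[OF lim_inverse_n'] .
    have "\<forall>\<^sub>F k in sequentially. (\<integral>x. indicator V x * q i k x \<partial>lborel) \<le> m"
    proof (rule eventually_mono)
      show "\<forall>\<^sub>F k in sequentially. 1 / real (Suc k) < \<delta>"
        by (rule order_tendstoD(2)[OF small \<delta>(1)])
      fix k assume k: "1 / real (Suc k) < \<delta>"
      define t where "t = 1 / real (Suc k)"
      have t: "t > 0" "t < \<delta>" using k by (auto simp: t_def)
      have "(\<integral>x. indicator V x * ((\<phi> (x + t *\<^sub>R axis i 1) $ i - \<phi> x $ i) / t) \<partial>lborel) \<le> m"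
      proof (rule integral_difference_quotient_le[OF V _ _ K(1) t(1) m])
        show "continuous_on UNIV (\<lambda>x. \<phi> x $ i)" by (intro continuous_intros c\<phi>)
        show "\<bar>\<phi> x $ i\<bar> \<le> indicator K x" for x
          using zero[of x] n\<phi>[of x] component_le_norm_cart[of "\<phi> x" i] by (cases "x \<in> K") auto
        have "emeasure lborel {z \<in> K. (z \<in> V) \<noteq> (z + (- t) *\<^sub>R axis i 1 \<in> V)}
            \<le> ennreal (m * norm ((- t) *\<^sub>R axis i 1 :: real^'n))"
          using \<delta>(2) t by (intro V_le[OF K(1), of \<delta>]) auto
        then show "emeasure lborel {z \<in> K. (z \<in> V) \<noteq> (z + (- t) *\<^sub>R axis i 1 \<in> V)} \<le> ennreal (m * t)"
          using t by simp
      qed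
      then show "(\<integral>x. indicator V x * q i k x \<partial>lborel) \<le> m" by (simp add: q_def t_def)
    qed
    moreover have "(\<lambda>k. \<integral>x. indicator V x * q i k x \<partial>lborel) \<longlonglongrightarrow> (\<integral>x. indicator V x * D i x \<partial>lborel)"
      by (rule integral_dominated_convergence[OF meas(2) meas(1) dom lim bd])
    ultimately show ?thesis by (intro tendsto_upperbound) auto
  qed
  have "(LINT x:V|lebesgue. divergence \<phi> x) = (\<integral>x. indicator V x * (\<Sum>i\<in>UNIV. D i x) \<partial>lebesgue)"
    by (simp add: set_lebesgue_integral_def div)
  also have "\<dots> = (\<integral>x. indicator V x * (\<Sum>i\<in>UNIV. D i x) \<partial>lborel)"
    by (rule integral_completion) measurable
  also have "\<dots> = (\<Sum>i\<in>UNIV. \<integral>x. indicator V x * D i x \<partial>lborel)"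
    unfolding sum_distrib_left using D_int by (rule Bochner_Integration.integral_sum)
  also have "\<dots> \<le> (\<Sum>i\<in>(UNIV::'n set). m)"
    by (intro sum_mono D_le)
  finally show "ereal (LINT x:V|lebesgue. divergence \<phi> x) \<le> ereal (CARD('n) * m)" by simp
qed

section \<open>The compactness theorem\<close>

text \<open>The integrand is the indicator of the set of disagreement, so the integral over
  \<open>K\<close> is the measure of that set.\<close>

lemma converges_L1_loc_indicator:
  fixes A V :: "(real^'n) set"
  assumes W [measurable]: "\<And>j. W j \<in> sets borel" and V [measurable]: "V \<in> sets borel"
    and conv: "\<And>K. compact K \<Longrightarrow> K \<subseteq> A \<Longrightarrow> (\<lambda>j. emeasure lborel {z \<in> K. (z \<in> W j) \<noteq> (z \<in> V)}) \<longlonglongrightarrow> 0"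
  shows "converges_L1_loc A (\<lambda>j. indicator (W j)) (indicator V)"
  unfolding converges_L1_loc_def
proof (intro allI impI)
  fix K assume "compact K \<and> K \<subseteq> A"
  then have K: "compact K" "K \<subseteq> A" by auto
  have Kb [measurable]: "K \<in> sets borel" using K by (simp add: borel_closed compact_imp_closed)
  have fin: "emeasure lborel (K \<inter> T) < \<infinity>" if "T \<in> sets borel" for T
  proof -
    have "emeasure lborel (K \<inter> T) \<le> emeasure lborel K" by (intro emeasure_mono) auto
    then show ?thesis using emeasure_compact_finite[OF K(1)] by simp
  qed
  have int: "set_integrable lebesgue K (indicator T :: _ \<Rightarrow> real)" if T: "T \<in> sets borel" for T
  proof -
    have "integrable lebesgue (indicator (K \<inter> T) :: _ \<Rightarrow> real)"
      using fin[OF T] T Kb by (simp add: emeasure_completion)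
    then show ?thesis by (simp add: set_integrable_def flip: indicator_inter_arith)
  qed
  have dist: "(LINT x:K|lebesgue. \<bar>indicator (W j) x - indicator V x\<bar>)
      = enn2real (emeasure lborel {z \<in> K. (z \<in> W j) \<noteq> (z \<in> V)})" for j
  proof -
    let ?S = "{z \<in> K. (z \<in> W j) \<noteq> (z \<in> V)}"
    have S: "?S \<in> sets lborel" by measurable
    have "(LINT x:K|lebesgue. \<bar>indicator (W j) x - indicator V x\<bar>) = (\<integral>x. indicator ?S x \<partial>lebesgue :: real)"
      unfolding set_lebesgue_integral_def
      by (intro Bochner_Integration.integral_cong) (simp_all add: indicator_def)
    also have "\<dots> = measure lebesgue ?S" by simp
    also have "\<dots> = measure lborel ?S" using S by (rule measure_completion)
    finally show ?thesis by (simp add: measure_def)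
  qed
  have "(\<lambda>j. enn2real (emeasure lborel {z \<in> K. (z \<in> W j) \<noteq> (z \<in> V)})) \<longlonglongrightarrow> 0"
    using conv[OF K] by (intro tendsto_enn2real) auto
  then show "(\<forall>j. set_integrable lebesgue K (indicator (W j) :: _ \<Rightarrow> real)) \<and> set_integrable lebesgue K (indicator V :: _ \<Rightarrow> real)
      \<and> (\<lambda>j. LINT x:K|lebesgue. \<bar>indicator (W j) x - indicator V x\<bar>) \<longlonglongrightarrow> (0 :: real)"
    using int[OF W] int[OF V] by (simp add: dist)
qed

lemma borel_Union_scaled_voronoi:
  assumes "countable X"
  shows "(\<Union>x\<in>X. scaled_voronoi L e x) \<in> sets borel"
proof (rule sets.countable_UN''[OF assms])
  show "scaled_voronoi L e x \<in> sets borel" for x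
    unfolding scaled_voronoi_def by (intro borel_closed closed_scaling closed_voronoi)
qed

text \<open>The tube estimate asks only for the margin \<open>norm h + e * R\<close>. With the
  larger margin \<open>norm h + 2 * (e * R)\<close> a single parameter serves both as margin and as
  error in the length.\<close>

lemma translation_bound_scaled_voronoi:
  fixes L :: "(real^'n) set"
  assumes clo: "\<And>Y. Y \<subseteq> L \<Longrightarrow> closed Y" and "countable L"
    and R: "\<forall>x. L \<inter> ball x R \<noteq> {}" "R > 0"
    and c: "\<And>z. ennreal (inverse C) \<le> c z" and C: "C > 0" and e: "e > 0" and M: "M \<ge> 0"
    and en: "nn_energy L c e X A \<le> ennreal M" and X: "X \<subseteq> (\<lambda>x. e *\<^sub>R x) ` L"
  shows "translation_bound A (unit_ball_vol CARD('n) * 2 ^ CARD('n) * R ^ (CARD('n) - 1) * (C * M)) (2 * (e * R))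
    (\<Union>x\<in>X. scaled_voronoi L e x)"
  unfolding translation_bound_def
proof (intro allI impI)
  fix K \<delta> and h :: "real^'n"
  assume K: "\<forall>z\<in>K. cball z \<delta> \<subseteq> A" and h: "norm h + 2 * (e * R) \<le> \<delta>"
  have "0 < e * R" using e R by simp
  then have "norm h + e * R \<le> \<delta>" using h by linarith
  then show "emeasure lborel {z \<in> K. (z \<in> (\<Union>x\<in>X. scaled_voronoi L e x)) \<noteq> (z + h \<in> (\<Union>x\<in>X. scaled_voronoi L e x))}
    \<le> ennreal (unit_ball_vol CARD('n) * 2 ^ CARD('n) * R ^ (CARD('n) - 1) * (C * M) * (norm h + 2 * (e * R)))"
    using K by (intro emeasure_transition_le[OF clo \<open>countable L\<close> R c C e M en X]) auto
qed

theorem proposition5p10: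
  fixes L A :: "(real ^ 'n) set"
    and c :: "real ^ 'n \<Rightarrow> ennreal" and C :: real
    and X :: "real \<Rightarrow> (real ^ 'n) set"
    and \<epsilon> :: "nat \<Rightarrow> real"
  assumes "admissible L" and "periodic L"
    and "C \<ge> 1" and "\<And>z. ennreal (inverse C) \<le> c z \<and> c z \<le> ennreal C"
    and "open A"
    and "\<And>e. e > 0 \<Longrightarrow> X e \<subseteq> (\<lambda>x. e *\<^sub>R x) ` L"
    and "(SUP e\<in>{0<..}. nn_energy L c e (X e) A) < \<infinity>"
    and "\<And>j. \<epsilon> j > 0" and "\<epsilon> \<longlonglongrightarrow> 0"
  shows "\<exists>V \<sigma>. V \<subseteq> A \<and> finite_perimeter_in V A \<and> strict_mono (\<sigma> :: nat \<Rightarrow> nat)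
           \<and> converges_L1_loc A
               (\<lambda>j. indicator (\<Union>x\<in>X (\<epsilon> (\<sigma> j)). scaled_voronoi L (\<epsilon> (\<sigma> j)) x))
               (indicator V)"
proof -
  obtain R where R: "\<forall>x. L \<inter> ball x R \<noteq> {}" "R > 0"
    using \<open>admissible L\<close> by (auto simp: admissible_def)
  obtain r where r: "\<forall>x\<in>L. infdist x (L - {x}) \<ge> r" "r > 0"
    using \<open>admissible L\<close> by (auto simp: admissible_def)
  have countL: "countable L" using \<open>admissible L\<close> by (simp add: admissible_def)
  have clo: "closed Y" if "Y \<subseteq> L" for Y
    by (rule uniformly_discrete_closed[OF r that])
  \<comment> \<open>The supremum is finite by hypothesis, so its real value bounds all energies. The
    constant \<open>M\<close> built from it is therefore independent of \<open>j\<close>.\<close>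
  define M0 where "M0 = enn2real (SUP e\<in>{0<..}. nn_energy L c e (X e) A)"
  have M0: "M0 \<ge> 0" by (simp add: M0_def)
  have energy: "nn_energy L c e (X e) A \<le> ennreal M0" if "e > 0" for e
  proof -
    have "nn_energy L c e (X e) A \<le> (SUP e\<in>{0<..}. nn_energy L c e (X e) A)"
      using that by (intro SUP_upper) auto
    also have "\<dots> = ennreal M0"
      using assms(7) by (simp add: M0_def)
    finally show ?thesis .
  qed
  define W where "W j = (\<Union>x\<in>X (\<epsilon> j). scaled_voronoi L (\<epsilon> j) x)" for j
  have Wb: "W j \<in> sets borel" for j
    unfolding W_def using assms(6)[OF assms(8)] countL
    by (intro borel_Union_scaled_voronoi) (meson countable_image countable_subset)
  define M where "M = unit_ball_vol CARD('n) * 2 ^ CARD('n) * R ^ (CARD('n) - 1) * (C * M0)"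
  have M: "M \<ge> 0" using R M0 \<open>C \<ge> 1\<close> by (simp add: M_def)
  define a where "a j = 2 * (\<epsilon> j * R)" for j
  have a: "a \<longlonglongrightarrow> 0" "\<And>j. a j \<ge> 0"
  proof -
    have "(\<lambda>j. 2 * (\<epsilon> j * R)) \<longlonglongrightarrow> 2 * (0 * R)"
      by (intro tendsto_intros assms(9))
    then show "a \<longlonglongrightarrow> 0" by (simp add: a_def[abs_def])
    show "a j \<ge> 0" for j using assms(8)[of j] R by (simp add: a_def)
  qed
  have tb: "translation_bound A M (a j) (W j)" for j
    unfolding W_def M_def a_def using \<open>C \<ge> 1\<close> assms(4)
    by (intro translation_bound_scaled_voronoi[OF clo countL R _ _ assms(8) M0 energy[OF assms(8)] assms(6)[OF assms(8)]]) auto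
  obtain V and \<sigma> :: "nat \<Rightarrow> nat" where V: "V \<in> sets borel" and VA: "V \<subseteq> A" and \<sigma>: "strict_mono \<sigma>"
    and conv: "\<And>K. compact K \<Longrightarrow> K \<subseteq> A \<Longrightarrow> (\<lambda>j. emeasure lborel {z \<in> K. (z \<in> W (\<sigma> j)) \<noteq> (z \<in> V)}) \<longlonglongrightarrow> 0"
    using compactness_translation_bound[OF Wb \<open>open A\<close> tb a M] by blast
  have "perimeter V A \<le> ereal (CARD('n) * M)"
  proof (rule perimeter_le[OF V \<open>open A\<close> M])
    fix K \<delta> and h :: "real^'n"
    assume "compact K" "\<And>z. z \<in> K \<Longrightarrow> cball z \<delta> \<subseteq> A" "norm h < \<delta>"
    note K = this
    have "(\<lambda>j. a (\<sigma> j)) \<longlonglongrightarrow> 0"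
      using LIMSEQ_subseq_LIMSEQ[OF a(1) \<sigma>] by (simp add: o_def)
    then show "emeasure lborel {z \<in> K. (z \<in> V) \<noteq> (z + h \<in> V)} \<le> ennreal (M * norm h)"
      by (rule translation_bound_limit[OF Wb V tb _ a(2) conv K])
  qed
  then have "finite_perimeter_in V A"
    using V by (auto simp: finite_perimeter_in_def)
  moreover have "converges_L1_loc A (\<lambda>j. indicator (W (\<sigma> j))) (indicator V)"
    by (rule converges_L1_loc_indicator[OF Wb V conv])
  ultimately show ?thesis
    using VA \<sigma> unfolding W_def by blast
qed

end
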